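(* Let $R$ be a commutative unital ring such that for every regular ideal $\mathfrak a$ of $R$ the quotient ring $R/\mathfrak a$ has stable rank $1$. Let $I$ be an ideal of $R$ which can be generated by two regular elements. Then the determinant map $(a,b)\mapsto a\wedge b$ induces a bijection from $V_2(I)/\mathrm{SL}_2(R)$ onto $V_1(\bigwedge^2 I)$.
   Context: Rings are commutative with identity. An element of $R$ is regular if it is not a zero divisor; an ideal is regular if it contains a regular element. A ring $A$ has stable rank $1$ if for all $a,b\in A$ with $Aa+Ab=A$ there is $r\in A$ such that $a+rb$ is a unit of $A$. For a finitely generated $R$-module $M$, $V_n(M)$ is the set of $n$-tuples in $M^n$ whose components generate $M$; $\mathrm{SL}_2(R)$ acts on $V_2(I)$ by right multiplication of row vectors by matrices. The module $\det(I)=\bigwedge^2 I$ is cyclic, and $V_1(\bigwedge^2 I)$ is the set of its generators. The determinant map $V_2(I)\to V_1(\bigwedge^2 I)$ is $(a,b)\mapsto a\wedge b$. *)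

theory Defs
  imports "HOL-Algebra.QuotRing" "HOL-Algebra.Module" "HOL-Algebra.Group_Action"
begin

definition regular_element :: "('a, 'm) ring_scheme \<Rightarrow> 'a \<Rightarrow> bool" where
  "regular_element R a \<longleftrightarrow>
     a \<in> carrier R \<and> (\<forall>x\<in>carrier R. a \<otimes>\<^bsub>R\<^esub> x = \<zero>\<^bsub>R\<^esub> \<longrightarrow> x = \<zero>\<^bsub>R\<^esub>)"

definition regular_ideal :: "('a, 'm) ring_scheme \<Rightarrow> 'a set \<Rightarrow> bool" where
  "regular_ideal R J \<longleftrightarrow> ideal J R \<and> (\<exists>a\<in>J. regular_element R a)"

definition stable_rank_one :: "('a, 'm) ring_scheme \<Rightarrow> bool" where
  "stable_rank_one A \<longleftrightarrow>
     (\<forall>a\<in>carrier A. \<forall>b\<in>carrier A.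
        PIdl\<^bsub>A\<^esub> a <+>\<^bsub>A\<^esub> PIdl\<^bsub>A\<^esub> b = carrier A \<longrightarrow>
        (\<exists>r\<in>carrier A. a \<oplus>\<^bsub>A\<^esub> r \<otimes>\<^bsub>A\<^esub> b \<in> Units A))"

text \<open>The record type of modules extends that of rings, so it has fields \<open>mult\<close> and \<open>one\<close>;
  these play no role in the theory of modules and are left unspecified below.\<close>

definition ideal_module :: "('a, 'm) ring_scheme \<Rightarrow> 'a set \<Rightarrow> ('a, 'a) module" where
  "ideal_module R I =
     \<lparr>carrier = I, mult = undefined, one = undefined, zero = \<zero>\<^bsub>R\<^esub>, add = add R, smult = mult R\<rparr>"

definition generated_submodule ::
    "('a, 'm) ring_scheme \<Rightarrow> ('a, 'b, 'n) module_scheme \<Rightarrow> 'b set \<Rightarrow> 'b set" where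
  "generated_submodule R M S = \<Inter>{N. submodule N R M \<and> S \<subseteq> N}"

definition quotient_module ::
    "('a, 'm) ring_scheme \<Rightarrow> ('a, 'b, 'n) module_scheme \<Rightarrow> 'b set \<Rightarrow> ('a, 'b set) module" where
  "quotient_module R M N =
     \<lparr>carrier = a_rcosets\<^bsub>M\<^esub> N, mult = undefined, one = undefined, zero = N, add = set_add M,
      smult = (\<lambda>c C. \<Union>x\<in>C. N +>\<^bsub>M\<^esub> (c \<odot>\<^bsub>M\<^esub> x))\<rparr>"

text \<open>The free module on a set \<open>X\<close>: finitely supported functions, zero outside \<open>X\<close>.\<close>

definition free_module :: "('a, 'm) ring_scheme \<Rightarrow> 'x set \<Rightarrow> ('a, 'x \<Rightarrow> 'a) module" where
  "free_module R X =
     \<lparr>carrier = {f. f \<in> X \<rightarrow> carrier R \<and> (\<forall>x. x \<notin> X \<longrightarrow> f x = \<zero>\<^bsub>R\<^esub>) \<and> finite {x. f x \<noteq> \<zero>\<^bsub>R\<^esub>}},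
      mult = undefined, one = undefined,
      zero = (\<lambda>x. \<zero>\<^bsub>R\<^esub>), add = (\<lambda>f g x. f x \<oplus>\<^bsub>R\<^esub> g x), smult = (\<lambda>c f x. c \<otimes>\<^bsub>R\<^esub> f x)\<rparr>"

definition free_basis :: "('a, 'm) ring_scheme \<Rightarrow> 'x \<Rightarrow> 'x \<Rightarrow> 'a" where
  "free_basis R x = (\<lambda>y. if y = x then \<one>\<^bsub>R\<^esub> else \<zero>\<^bsub>R\<^esub>)"

text \<open>The exterior square is presented by generators \<open>x \<and> y\<close>, for \<open>x\<close> and \<open>y\<close> in \<open>M\<close>,
  subject to bilinearity and \<open>x \<and> x = 0\<close>.\<close>

definition exterior_relators ::
    "('a, 'm) ring_scheme \<Rightarrow> ('a, 'b, 'n) module_scheme \<Rightarrow> ('b \<times> 'b \<Rightarrow> 'a) set" where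
  "exterior_relators R M =
    (let F = free_module R (carrier M \<times> carrier M); e = (\<lambda>x y. free_basis R (x, y)) in
       {e (x \<oplus>\<^bsub>M\<^esub> y) z \<ominus>\<^bsub>F\<^esub> (e x z \<oplus>\<^bsub>F\<^esub> e y z) | x y z.
          x \<in> carrier M \<and> y \<in> carrier M \<and> z \<in> carrier M}
     \<union> {e x (y \<oplus>\<^bsub>M\<^esub> z) \<ominus>\<^bsub>F\<^esub> (e x y \<oplus>\<^bsub>F\<^esub> e x z) | x y z.
          x \<in> carrier M \<and> y \<in> carrier M \<and> z \<in> carrier M}
     \<union> {e (c \<odot>\<^bsub>M\<^esub> x) y \<ominus>\<^bsub>F\<^esub> c \<odot>\<^bsub>F\<^esub> e x y | c x y.
          c \<in> carrier R \<and> x \<in> carrier M \<and> y \<in> carrier M}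
     \<union> {e x (c \<odot>\<^bsub>M\<^esub> y) \<ominus>\<^bsub>F\<^esub> c \<odot>\<^bsub>F\<^esub> e x y | c x y.
          c \<in> carrier R \<and> x \<in> carrier M \<and> y \<in> carrier M}
     \<union> {e x x | x. x \<in> carrier M})"

definition exterior_null ::
    "('a, 'm) ring_scheme \<Rightarrow> ('a, 'b, 'n) module_scheme \<Rightarrow> ('b \<times> 'b \<Rightarrow> 'a) set" where
  "exterior_null R M =
     generated_submodule R (free_module R (carrier M \<times> carrier M)) (exterior_relators R M)"

definition exterior_square ::
    "('a, 'm) ring_scheme \<Rightarrow> ('a, 'b, 'n) module_scheme \<Rightarrow> ('a, ('b \<times> 'b \<Rightarrow> 'a) set) module" where
  "exterior_square R M =
     quotient_module R (free_module R (carrier M \<times> carrier M)) (exterior_null R M)"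

definition wedge ::
    "('a, 'm) ring_scheme \<Rightarrow> ('a, 'b, 'n) module_scheme \<Rightarrow> 'b \<Rightarrow> 'b \<Rightarrow> ('b \<times> 'b \<Rightarrow> 'a) set" where
  "wedge R M x y =
     exterior_null R M +>\<^bsub>free_module R (carrier M \<times> carrier M)\<^esub> free_basis R (x, y)"

text \<open>\<open>generating_tuples R M n\<close> is the set \<open>V\<^sub>n(M)\<close>, with tuples represented as lists.\<close>

definition generating_tuples ::
    "('a, 'm) ring_scheme \<Rightarrow> ('a, 'b, 'n) module_scheme \<Rightarrow> nat \<Rightarrow> 'b list set" where
  "generating_tuples R M n =
     {v. length v = n \<and> set v \<subseteq> carrier M \<and> generated_submodule R M (set v) = carrier M}"

text \<open>The tuple \<open>(p, q, r, s)\<close> stands for the matrix with rows \<open>(p, q)\<close> and \<open>(r, s)\<close>.\<close>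

definition SL2 :: "('a, 'm) ring_scheme \<Rightarrow> ('a \<times> 'a \<times> 'a \<times> 'a) monoid" where
  "SL2 R =
     \<lparr>carrier = {(p, q, r, s). p \<in> carrier R \<and> q \<in> carrier R \<and> r \<in> carrier R \<and> s \<in> carrier R \<and>
                  p \<otimes>\<^bsub>R\<^esub> s \<ominus>\<^bsub>R\<^esub> q \<otimes>\<^bsub>R\<^esub> r = \<one>\<^bsub>R\<^esub>},
      mult = (\<lambda>(p, q, r, s) (p', q', r', s').
        (p \<otimes>\<^bsub>R\<^esub> p' \<oplus>\<^bsub>R\<^esub> q \<otimes>\<^bsub>R\<^esub> r', p \<otimes>\<^bsub>R\<^esub> q' \<oplus>\<^bsub>R\<^esub> q \<otimes>\<^bsub>R\<^esub> s',
         r \<otimes>\<^bsub>R\<^esub> p' \<oplus>\<^bsub>R\<^esub> s \<otimes>\<^bsub>R\<^esub> r', r \<otimes>\<^bsub>R\<^esub> q' \<oplus>\<^bsub>R\<^esub> s \<otimes>\<^bsub>R\<^esub> s')),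
      one = (\<one>\<^bsub>R\<^esub>, \<zero>\<^bsub>R\<^esub>, \<zero>\<^bsub>R\<^esub>, \<one>\<^bsub>R\<^esub>)\<rparr>"

text \<open>Right multiplication of a row vector of length two by a matrix. As this is a right action,
  it is not a \<^const>\<open>group_action\<close>; only \<^const>\<open>orbits\<close> is used, which is insensitive to the side.\<close>

definition row_action ::
    "('a, 'b, 'n) module_scheme \<Rightarrow> 'a \<times> 'a \<times> 'a \<times> 'a \<Rightarrow> 'b list \<Rightarrow> 'b list" where
  "row_action M = (\<lambda>(p, q, r, s) v.
     [p \<odot>\<^bsub>M\<^esub> v ! 0 \<oplus>\<^bsub>M\<^esub> r \<odot>\<^bsub>M\<^esub> v ! 1, q \<odot>\<^bsub>M\<^esub> v ! 0 \<oplus>\<^bsub>M\<^esub> s \<odot>\<^bsub>M\<^esub> v ! 1])"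

definition determinant_map ::
    "('a, 'm) ring_scheme \<Rightarrow> ('a, 'b, 'n) module_scheme \<Rightarrow> 'b list \<Rightarrow> ('b \<times> 'b \<Rightarrow> 'a) set list" where
  "determinant_map R M v = [wedge R M (v ! 0) (v ! 1)]"

end

theory Submission
  imports Defs
begin

text \<open>Let \<open>a, b\<close> generate \<open>I\<close>, and let \<open>J\<close> be the ideal generated by the coefficients of all relations
  \<open>k a + l b = 0\<close>. Then \<open>a \<and> b\<close> generates the exterior square of \<open>I\<close>, with annihilator \<open>J\<close>.

  Injectivity holds as soon as \<open>I\<close> is regular. Write \<open>(a', b') = (a, b) A\<close> for a second generating pair
  with \<open>a' \<and> b' = a \<and> b\<close>, so that \<open>det A = 1\<close> modulo \<open>J\<close>. Adding relations to the columns of \<open>A\<close>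
  does not affect \<open>(a, b) A\<close>. Since \<open>I\<close> is faithful, all minors of relations vanish, so \<open>det A\<close> changes by
  a linear expression in these relations; the values of this expression form an ideal that
  contains \<open>J\<close> because \<open>a', b'\<close> generate \<open>I\<close>. Hence \<open>A\<close> can be chosen with determinant \<open>1\<close>.

  For surjectivity, let \<open>b\<close> be regular, and let \<open>u (a \<and> b)\<close> be a generator, so that \<open>u\<close> is a unit modulo \<open>J\<close>.
  As \<open>R / b R\<close> has stable rank \<open>1\<close>, one can change \<open>u\<close> modulo \<open>J\<close> into a unit modulo \<open>b\<close>.
  Then \<open>(u a, b)\<close> generates \<open>I\<close> and is mapped to \<open>u (a \<and> b)\<close>.\<close>

section \<open>Relations between two ring elements\<close>

context cring begin

definition relation :: "'a \<Rightarrow> 'a \<Rightarrow> 'a \<Rightarrow> 'a \<Rightarrow> bool" where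
  "relation a b k l \<longleftrightarrow> k \<in> carrier R \<and> l \<in> carrier R \<and> k \<otimes> a \<oplus> l \<otimes> b = \<zero>"

text \<open>Known as the first Fitting ideal of the ideal generated by \<open>a\<close> and
  \<open>b\<close>: it is generated by the entries of a relation matrix for these two
  generators.\<close>

definition relation_ideal :: "'a \<Rightarrow> 'a \<Rightarrow> 'a set" where
  "relation_ideal a b = Idl ({k. \<exists>l. relation a b k l} \<union> {l. \<exists>k. relation a b k l})"

lemma relation_carrier:
  assumes "relation a b k l"
  shows "k \<in> carrier R" "l \<in> carrier R"
  using assms by (auto simp: relation_def)

lemma relation_coefficients_carrier:
  "{k. \<exists>l. relation a b k l} \<union> {l. \<exists>k. relation a b k l} \<subseteq> carrier R"
  by (auto simp: relation_def)

lemma relation_ideal_ideal: "ideal (relation_ideal a b) R"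
  unfolding relation_ideal_def by (rule genideal_ideal[OF relation_coefficients_carrier])

lemma relation_imp_relation_ideal:
  assumes "relation a b k l"
  shows "k \<in> relation_ideal a b" "l \<in> relation_ideal a b"
  using assms genideal_self[OF relation_coefficients_carrier, of a b]
  unfolding relation_ideal_def by blast+

lemma relation_zero:
  assumes "a \<in> carrier R" "b \<in> carrier R"
  shows "relation a b \<zero> \<zero>"
  using assms by (simp add: relation_def)

lemma relation_add:
  assumes "a \<in> carrier R" "b \<in> carrier R" and r: "relation a b k l" "relation a b m n"
  shows "relation a b (k \<oplus> m) (l \<oplus> n)"
proof -
  note relation_carrier[OF r(1)] relation_carrier[OF r(2)]
  moreover have "(k \<oplus> m) \<otimes> a \<oplus> (l \<oplus> n) \<otimes> b = (k \<otimes> a \<oplus> l \<otimes> b) \<oplus> (m \<otimes> a \<oplus> n \<otimes> b)"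
    using assms(1,2) calculation by algebra
  ultimately show ?thesis using r by (simp add: relation_def)
qed

lemma relation_smult:
  assumes "a \<in> carrier R" "b \<in> carrier R" "c \<in> carrier R" and r: "relation a b k l"
  shows "relation a b (c \<otimes> k) (c \<otimes> l)"
proof -
  note relation_carrier[OF r]
  moreover have "(c \<otimes> k) \<otimes> a \<oplus> (c \<otimes> l) \<otimes> b = c \<otimes> (k \<otimes> a \<oplus> l \<otimes> b)"
    using assms(1-3) calculation by algebra
  ultimately show ?thesis using r assms(3) by (simp add: relation_def)
qed

lemma relation_diff:
  assumes c: "a \<in> carrier R" "b \<in> carrier R" "k \<in> carrier R" "l \<in> carrier R" "m \<in> carrier R" "n \<in> carrier R"
    and eq: "k \<otimes> a \<oplus> l \<otimes> b = m \<otimes> a \<oplus> n \<otimes> b"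
  shows "relation a b (k \<ominus> m) (l \<ominus> n)"
proof -
  have "(k \<ominus> m) \<otimes> a \<oplus> (l \<ominus> n) \<otimes> b = (k \<otimes> a \<oplus> l \<otimes> b) \<ominus> (m \<otimes> a \<oplus> n \<otimes> b)"
    using c by algebra
  also have "\<dots> = \<zero>" unfolding eq using c by algebra
  finally show ?thesis using c by (simp add: relation_def)
qed

section \<open>Determinants of base changes between generating pairs\<close>

definition faithful_pair :: "'a \<Rightarrow> 'a \<Rightarrow> bool" where
  "faithful_pair a b \<longleftrightarrow> (\<forall>x\<in>carrier R. x \<otimes> a = \<zero> \<and> x \<otimes> b = \<zero> \<longrightarrow> x = \<zero>)"

text \<open>By Cramer's rule the minor of two relations kills both \<open>a\<close> and
  \<open>b\<close>.\<close>

lemma relation_minor_zero: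
  assumes c: "a \<in> carrier R" "b \<in> carrier R" and f: "faithful_pair a b"
    and r: "relation a b k l" "relation a b m n"
  shows "k \<otimes> n \<ominus> m \<otimes> l = \<zero>"
proof -
  note cs = c relation_carrier[OF r(1)] relation_carrier[OF r(2)]
  have "(k \<otimes> n \<ominus> m \<otimes> l) \<otimes> a = n \<otimes> (k \<otimes> a \<oplus> l \<otimes> b) \<ominus> l \<otimes> (m \<otimes> a \<oplus> n \<otimes> b)"
    using cs by algebra
  also have "\<dots> = \<zero>" using r cs by (simp add: relation_def a_minus_def)
  finally have 1: "(k \<otimes> n \<ominus> m \<otimes> l) \<otimes> a = \<zero>" .
  have "(k \<otimes> n \<ominus> m \<otimes> l) \<otimes> b = k \<otimes> (m \<otimes> a \<oplus> n \<otimes> b) \<ominus> m \<otimes> (k \<otimes> a \<oplus> l \<otimes> b)"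
    using cs by algebra
  also have "\<dots> = \<zero>" using r cs by (simp add: relation_def a_minus_def)
  finally have "(k \<otimes> n \<ominus> m \<otimes> l) \<otimes> b = \<zero>" .
  moreover have "k \<otimes> n \<ominus> m \<otimes> l \<in> carrier R" using cs by simp
  ultimately show ?thesis using f 1 unfolding faithful_pair_def by blast
qed

text \<open>For \<open>(a, b) A = (a', b')\<close> and \<open>(a', b') B = (a, b)\<close>, the columns of \<open>1 - A B\<close> are relations
  between \<open>a\<close> and \<open>b\<close>. Adding relations to the columns of \<open>A\<close> changes \<open>det A\<close> by an element of
  the ideal below, as the minors of relations vanish.\<close>

definition determinant_shifts :: "'a \<Rightarrow> 'a \<Rightarrow> 'a \<Rightarrow> 'a \<Rightarrow> 'a \<Rightarrow> 'a \<Rightarrow> 'a set" where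
  "determinant_shifts a b p q r s =
     {s \<otimes> k \<ominus> q \<otimes> l \<oplus> p \<otimes> n \<ominus> r \<otimes> m | k l m n. relation a b k l \<and> relation a b m n}"

text \<open>Relations between \<open>a\<close> and \<open>b\<close> form a module, and the
  expression in the definition is linear in the pair of relations, so its values form an
  ideal.\<close>

lemma determinant_shifts_ideal:
  assumes c: "a \<in> carrier R" "b \<in> carrier R" "p \<in> carrier R" "q \<in> carrier R" "r \<in> carrier R" "s \<in> carrier R"
  shows "ideal (determinant_shifts a b p q r s) R"
proof -
  let ?J = "determinant_shifts a b p q r s"
  have sub: "?J \<subseteq> carrier R"
    using c by (auto simp: determinant_shifts_def relation_def)
  have smult: "x \<otimes> j \<in> ?J" if x: "x \<in> carrier R" and j: "j \<in> ?J" for x j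
  proof -
    obtain k l m n where j: "j = s \<otimes> k \<ominus> q \<otimes> l \<oplus> p \<otimes> n \<ominus> r \<otimes> m"
      and rel: "relation a b k l" "relation a b m n"
      using j by (auto simp: determinant_shifts_def)
    note relation_carrier[OF rel(1)] relation_carrier[OF rel(2)]
    then have "x \<otimes> j = s \<otimes> (x \<otimes> k) \<ominus> q \<otimes> (x \<otimes> l) \<oplus> p \<otimes> (x \<otimes> n) \<ominus> r \<otimes> (x \<otimes> m)"
      unfolding j using c x by algebra
    then show ?thesis
      using relation_smult[OF c(1,2) x] rel unfolding determinant_shifts_def by blast
  qed
  have add: "i \<oplus> j \<in> ?J" if i: "i \<in> ?J" and j: "j \<in> ?J" for i j
  proof -
    obtain k l m n where i: "i = s \<otimes> k \<ominus> q \<otimes> l \<oplus> p \<otimes> n \<ominus> r \<otimes> m"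
      and rel: "relation a b k l" "relation a b m n"
      using i by (auto simp: determinant_shifts_def)
    obtain k' l' m' n' where j: "j = s \<otimes> k' \<ominus> q \<otimes> l' \<oplus> p \<otimes> n' \<ominus> r \<otimes> m'"
      and rel': "relation a b k' l'" "relation a b m' n'"
      using j by (auto simp: determinant_shifts_def)
    note relation_carrier[OF rel(1)] relation_carrier[OF rel(2)]
      relation_carrier[OF rel'(1)] relation_carrier[OF rel'(2)]
    then have "i \<oplus> j = s \<otimes> (k \<oplus> k') \<ominus> q \<otimes> (l \<oplus> l') \<oplus> p \<otimes> (n \<oplus> n') \<ominus> r \<otimes> (m \<oplus> m')"
      unfolding i j using c by algebra
    then show ?thesis
      using relation_add[OF c(1,2) rel(1) rel'(1)] relation_add[OF c(1,2) rel(2) rel'(2)]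
      unfolding determinant_shifts_def by blast
  qed
  have zero: "\<zero> \<in> ?J"
  proof -
    have "\<zero> = s \<otimes> \<zero> \<ominus> q \<otimes> \<zero> \<oplus> p \<otimes> \<zero> \<ominus> r \<otimes> \<zero>" using c by algebra
    then show ?thesis
      using relation_zero[OF c(1,2)] unfolding determinant_shifts_def by blast
  qed
  have neg: "\<ominus> j \<in> ?J" if j: "j \<in> ?J" for j
    using smult[OF _ j, of "\<ominus> \<one>"] sub j by (auto simp: l_minus)
  show ?thesis
  proof (rule idealI[OF ring_axioms])
    show "subgroup ?J (add_monoid R)"
      using sub zero add neg by (intro add.subgroupI) (auto simp: a_inv_def)
    fix x j assume "j \<in> ?J" "x \<in> carrier R"
    then show "x \<otimes> j \<in> ?J" "j \<otimes> x \<in> ?J" using smult[of x j] sub by (auto simp: m_comm)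
  qed
qed

text \<open>Let A and B be the matrices with entries \<open>p, q, r, s\<close> and
  \<open>p', q', r', s'\<close>. Expanding the determinant of A B + (1 - A B) writes 1 as det A det
  B plus a shift. It remains to see that det A det B times a coefficient of a relation is a shift,
  which follows from Cramer's rule for A and for B.\<close>

lemma relation_ideal_subset_determinant_shifts:
  assumes c: "a \<in> carrier R" "b \<in> carrier R" "p \<in> carrier R" "q \<in> carrier R" "r \<in> carrier R" "s \<in> carrier R"
    and c': "p' \<in> carrier R" "q' \<in> carrier R" "r' \<in> carrier R" "s' \<in> carrier R"
    and f: "faithful_pair a b"
    and A: "a' = p \<otimes> a \<oplus> r \<otimes> b" "b' = q \<otimes> a \<oplus> s \<otimes> b"
    and B: "a = p' \<otimes> a' \<oplus> r' \<otimes> b'" "b = q' \<otimes> a' \<oplus> s' \<otimes> b'"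
  shows "relation_ideal a b \<subseteq> determinant_shifts a b p q r s"
proof -
  define d e where de: "d = p \<otimes> s \<ominus> q \<otimes> r" "e = p' \<otimes> s' \<ominus> q' \<otimes> r'"
  \<comment> \<open>These are the entries of A B; below, \<open>(u1, u2)\<close> and
    \<open>(v1, v2)\<close> are the columns of 1 - A B.\<close>
  define m11 m12 m21 m22 where m: "m11 = p \<otimes> p' \<oplus> q \<otimes> r'" "m12 = p \<otimes> q' \<oplus> q \<otimes> s'"
      "m21 = r \<otimes> p' \<oplus> s \<otimes> r'" "m22 = r \<otimes> q' \<oplus> s \<otimes> s'"
  define u1 u2 v1 v2 where uv: "u1 = \<one> \<ominus> m11" "u2 = \<zero> \<ominus> m21" "v1 = \<zero> \<ominus> m12" "v2 = \<one> \<ominus> m22"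
  have cd: "d \<in> carrier R" "e \<in> carrier R"
    using c c' by (auto simp: de)
  have cm: "m11 \<in> carrier R" "m12 \<in> carrier R" "m21 \<in> carrier R" "m22 \<in> carrier R"
    using c c' by (auto simp: m)
  have cuv: "u1 \<in> carrier R" "u2 \<in> carrier R" "v1 \<in> carrier R" "v2 \<in> carrier R"
    using cm by (auto simp: uv)
  \<comment> \<open>Substituting the equations for A into those for B gives (a, b) A B = (a, b), so
    the columns of 1 - A B are relations.\<close>
  have relu: "relation a b u1 u2"
    unfolding uv
  proof (rule relation_diff)
    have "a = p' \<otimes> (p \<otimes> a \<oplus> r \<otimes> b) \<oplus> r' \<otimes> (q \<otimes> a \<oplus> s \<otimes> b)" by (rule B(1)[unfolded A])
    moreover have "\<dots> = m11 \<otimes> a \<oplus> m21 \<otimes> b" unfolding m using c c' by algebra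
    ultimately show "\<one> \<otimes> a \<oplus> \<zero> \<otimes> b = m11 \<otimes> a \<oplus> m21 \<otimes> b" using c by simp
  qed (use c cm in auto)
  have relv: "relation a b v1 v2"
    unfolding uv
  proof (rule relation_diff)
    have "b = q' \<otimes> (p \<otimes> a \<oplus> r \<otimes> b) \<oplus> s' \<otimes> (q \<otimes> a \<oplus> s \<otimes> b)" by (rule B(2)[unfolded A])
    moreover have "\<dots> = m12 \<otimes> a \<oplus> m22 \<otimes> b" unfolding m using c c' by algebra
    ultimately show "\<zero> \<otimes> a \<oplus> \<one> \<otimes> b = m12 \<otimes> a \<oplus> m22 \<otimes> b" using c by simp
  qed (use c cm in auto)
  have minor: "u1 \<otimes> v2 \<ominus> v1 \<otimes> u2 = \<zero>"
    by (rule relation_minor_zero[OF c(1,2) f relu relv])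
  note lin = relation_add relation_smult c c' cuv relu relv a_inv_closed m_closed
  \<comment> \<open>The determinant of the identity matrix, written as A B + (1 - A B), splits into
    det (A B), the mixed terms and det (1 - A B). The last one vanishes by
    \<open>minor\<close>.\<close>
  have "\<one> = (m11 \<otimes> m22 \<ominus> m12 \<otimes> m21) \<oplus> (u1 \<otimes> m22 \<ominus> v1 \<otimes> m21 \<oplus> m11 \<otimes> v2 \<ominus> m12 \<otimes> u2)
      \<oplus> (u1 \<otimes> v2 \<ominus> v1 \<otimes> u2)"
    unfolding uv using cm by algebra
  also have "m11 \<otimes> m22 \<ominus> m12 \<otimes> m21 = d \<otimes> e"
    unfolding m de using c c' by algebra
  \<comment> \<open>The mixed terms are the trace of adj (A B) (1 - A B), which equals the trace of
    adj A (1 - A B) adj B. The columns of (1 - A B) adj B are again relations, so this is a shift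
    for A.\<close>
  also have "u1 \<otimes> m22 \<ominus> v1 \<otimes> m21 \<oplus> m11 \<otimes> v2 \<ominus> m12 \<otimes> u2
      = s \<otimes> (s' \<otimes> u1 \<oplus> \<ominus> r' \<otimes> v1) \<ominus> q \<otimes> (s' \<otimes> u2 \<oplus> \<ominus> r' \<otimes> v2)
       \<oplus> p \<otimes> (p' \<otimes> v2 \<oplus> \<ominus> q' \<otimes> u2) \<ominus> r \<otimes> (p' \<otimes> v1 \<oplus> \<ominus> q' \<otimes> u1)"
    unfolding m using c c' cuv by algebra
  finally have one: "\<one> = d \<otimes> e \<oplus>
      (s \<otimes> (s' \<otimes> u1 \<oplus> \<ominus> r' \<otimes> v1) \<ominus> q \<otimes> (s' \<otimes> u2 \<oplus> \<ominus> r' \<otimes> v2)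
       \<oplus> p \<otimes> (p' \<otimes> v2 \<oplus> \<ominus> q' \<otimes> u2) \<ominus> r \<otimes> (p' \<otimes> v1 \<oplus> \<ominus> q' \<otimes> u1))"
    (is "_ = _ \<oplus> (s \<otimes> ?k1 \<ominus> q \<otimes> ?k2 \<oplus> p \<otimes> ?l2 \<ominus> r \<otimes> ?l1)")
    using minor c c' cd cuv by simp
  have ckl: "?k1 \<in> carrier R" "?k2 \<in> carrier R" "?l1 \<in> carrier R" "?l2 \<in> carrier R"
    using c' cuv by simp_all
  have rel1: "relation a b ?k1 ?k2" "relation a b ?l1 ?l2"
    by (intro lin)+
  \<comment> \<open>The expansion of 1 is multiplied by \<open>x\<close>. The term
    \<open>f1 \<otimes> (s \<otimes> y \<ominus> q \<otimes> z)\<close> is the shift with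
    \<open>f1\<close> times the relation in the first column, and the term with \<open>f2\<close> is
    the same for the second column; both are absorbed into the shift coming from the
    expansion.\<close>
  have shift: "x \<in> determinant_shifts a b p q r s"
    if x: "x \<in> carrier R" and y: "relation a b y z"
      and f: "f1 \<in> carrier R" "f2 \<in> carrier R"
      and xd: "x \<otimes> (d \<otimes> e) = f1 \<otimes> (s \<otimes> y \<ominus> q \<otimes> z) \<oplus> f2 \<otimes> (p \<otimes> z \<ominus> r \<otimes> y)" for x y z f1 f2
  proof -
    \<comment> \<open>Only the equation for 1 matters here, not how the four coefficients arise from
      B, so they are taken arbitrary.\<close>
    have gen: "x = s \<otimes> (f1 \<otimes> y \<oplus> x \<otimes> k1) \<ominus> q \<otimes> (f1 \<otimes> z \<oplus> x \<otimes> k2)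
        \<oplus> p \<otimes> (f2 \<otimes> z \<oplus> x \<otimes> l2) \<ominus> r \<otimes> (f2 \<otimes> y \<oplus> x \<otimes> l1)"
      if k: "k1 \<in> carrier R" "k2 \<in> carrier R" "l1 \<in> carrier R" "l2 \<in> carrier R"
        and one: "\<one> = d \<otimes> e \<oplus> (s \<otimes> k1 \<ominus> q \<otimes> k2 \<oplus> p \<otimes> l2 \<ominus> r \<otimes> l1)" for k1 k2 l1 l2
    proof -
      have "x = x \<otimes> (d \<otimes> e \<oplus> (s \<otimes> k1 \<ominus> q \<otimes> k2 \<oplus> p \<otimes> l2 \<ominus> r \<otimes> l1))"
        unfolding one[symmetric] using x by simp
      also have "\<dots> = x \<otimes> (d \<otimes> e) \<oplus> x \<otimes> (s \<otimes> k1 \<ominus> q \<otimes> k2 \<oplus> p \<otimes> l2 \<ominus> r \<otimes> l1)"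
        using x c cd k by (intro r_distr) simp_all
      also have "\<dots> = s \<otimes> (f1 \<otimes> y \<oplus> x \<otimes> k1) \<ominus> q \<otimes> (f1 \<otimes> z \<oplus> x \<otimes> k2)
          \<oplus> p \<otimes> (f2 \<otimes> z \<oplus> x \<otimes> l2) \<ominus> r \<otimes> (f2 \<otimes> y \<oplus> x \<otimes> l1)"
        unfolding xd using x f c k relation_carrier[OF y] by algebra
      finally show ?thesis .
    qed
    have "relation a b (f1 \<otimes> y \<oplus> x \<otimes> ?k1) (f1 \<otimes> z \<oplus> x \<otimes> ?k2)"
      "relation a b (f2 \<otimes> y \<oplus> x \<otimes> ?l1) (f2 \<otimes> z \<oplus> x \<otimes> ?l2)"
      by (intro relation_add relation_smult c(1,2) rel1 f x y)+
    then show ?thesis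
      using gen[OF ckl one] unfolding determinant_shifts_def by blast
  qed
  have "k \<in> determinant_shifts a b p q r s \<and> l \<in> determinant_shifts a b p q r s"
    if kl: "relation a b k l" for k l
  proof -
    note ckl = relation_carrier[OF kl]
    \<comment> \<open>The column \<open>(g, h)\<close> is B applied to the column
      \<open>(k, l)\<close>.\<close>
    define g h where gh: "g = k \<otimes> p' \<oplus> l \<otimes> q'" "h = k \<otimes> r' \<oplus> l \<otimes> s'"
    have cgh: "g \<in> carrier R" "h \<in> carrier R" using ckl c' by (simp_all add: gh)
    \<comment> \<open>Subtracting (1 - A B) (k, l), a combination of the columns of 1 - A B, from
      the relation \<open>(k, l)\<close> leaves A B (k, l) = A (g, h), which is therefore a
      relation.\<close>
    have "relation a b (k \<oplus> (\<ominus> k \<otimes> u1 \<oplus> \<ominus> l \<otimes> v1)) (l \<oplus> (\<ominus> k \<otimes> u2 \<oplus> \<ominus> l \<otimes> v2))"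
      by (intro lin kl ckl)
    moreover have "k \<oplus> (\<ominus> k \<otimes> u1 \<oplus> \<ominus> l \<otimes> v1) = k \<otimes> m11 \<oplus> l \<otimes> m12"
      "l \<oplus> (\<ominus> k \<otimes> u2 \<oplus> \<ominus> l \<otimes> v2) = k \<otimes> m21 \<oplus> l \<otimes> m22"
      unfolding uv using ckl cm by algebra+
    moreover have "k \<otimes> m11 \<oplus> l \<otimes> m12 = p \<otimes> g \<oplus> q \<otimes> h" "k \<otimes> m21 \<oplus> l \<otimes> m22 = r \<otimes> g \<oplus> s \<otimes> h"
      unfolding m gh using ckl c c' by algebra+
    ultimately have y: "relation a b (p \<otimes> g \<oplus> q \<otimes> h) (r \<otimes> g \<oplus> s \<otimes> h)" by simp
    \<comment> \<open>The adjugate of A turns A (g, h) into det A times \<open>(g, h)\<close>; the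
      adjugate of B then recovers det B times \<open>(k, l)\<close> from
      \<open>(g, h)\<close>.\<close>
    have adj: "s \<otimes> (p \<otimes> g \<oplus> q \<otimes> h) \<ominus> q \<otimes> (r \<otimes> g \<oplus> s \<otimes> h) = d \<otimes> g"
      "p \<otimes> (r \<otimes> g \<oplus> s \<otimes> h) \<ominus> r \<otimes> (p \<otimes> g \<oplus> q \<otimes> h) = d \<otimes> h"
      unfolding de using c cgh by algebra+
    have "k \<otimes> (d \<otimes> e) = s' \<otimes> (d \<otimes> g) \<oplus> \<ominus> q' \<otimes> (d \<otimes> h)"
      unfolding de(2) gh using c' ckl cd by algebra
    moreover have "l \<otimes> (d \<otimes> e) = \<ominus> r' \<otimes> (d \<otimes> g) \<oplus> p' \<otimes> (d \<otimes> h)"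
      unfolding de(2) gh using c' ckl cd by algebra
    ultimately show ?thesis
      using shift[OF ckl(1) y, of s' "\<ominus> q'"] shift[OF ckl(2) y, of "\<ominus> r'" p'] c'
      by (simp only: adj a_inv_closed)
  qed
  then show ?thesis
    unfolding relation_ideal_def
    by (intro genideal_minimal determinant_shifts_ideal c) blast
qed

text \<open>Two relations whose shift is 1 - det A are added to the columns of A. This keeps (a, b)
  A, and the determinant becomes exactly 1 because its part quadratic in the relations is a
  vanishing minor.\<close>

lemma base_change_determinant_one:
  assumes c: "a \<in> carrier R" "b \<in> carrier R" "p \<in> carrier R" "q \<in> carrier R" "r \<in> carrier R" "s \<in> carrier R"
    and c': "p' \<in> carrier R" "q' \<in> carrier R" "r' \<in> carrier R" "s' \<in> carrier R"
    and f: "faithful_pair a b"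
    and A: "a' = p \<otimes> a \<oplus> r \<otimes> b" "b' = q \<otimes> a \<oplus> s \<otimes> b"
    and B: "a = p' \<otimes> a' \<oplus> r' \<otimes> b'" "b = q' \<otimes> a' \<oplus> s' \<otimes> b'"
    and d: "\<one> \<ominus> (p \<otimes> s \<ominus> q \<otimes> r) \<in> relation_ideal a b"
  obtains p1 q1 r1 s1 where "(p1, q1, r1, s1) \<in> carrier (SL2 R)"
    "a' = p1 \<otimes> a \<oplus> r1 \<otimes> b" "b' = q1 \<otimes> a \<oplus> s1 \<otimes> b"
proof -
  obtain k l m n where rel: "relation a b k l" "relation a b m n"
    and eq: "\<one> \<ominus> (p \<otimes> s \<ominus> q \<otimes> r) = s \<otimes> k \<ominus> q \<otimes> l \<oplus> p \<otimes> n \<ominus> r \<otimes> m"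
    using subsetD[OF relation_ideal_subset_determinant_shifts[OF c c' f A B] d]
    by (auto simp: determinant_shifts_def)
  note ck = relation_carrier[OF rel(1)] relation_carrier[OF rel(2)]
  have "(p \<oplus> k) \<otimes> (s \<oplus> n) \<ominus> (q \<oplus> m) \<otimes> (r \<oplus> l)
      = (p \<otimes> s \<ominus> q \<otimes> r) \<oplus> (s \<otimes> k \<ominus> q \<otimes> l \<oplus> p \<otimes> n \<ominus> r \<otimes> m) \<oplus> (k \<otimes> n \<ominus> m \<otimes> l)"
    using c ck by algebra
  also have "\<dots> = \<one>"
    unfolding relation_minor_zero[OF c(1,2) f rel] eq[symmetric] using c by algebra
  finally have "(p \<oplus> k, q \<oplus> m, r \<oplus> l, s \<oplus> n) \<in> carrier (SL2 R)"
    using c ck by (simp add: SL2_def)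
  moreover have "(p \<oplus> k) \<otimes> a \<oplus> (r \<oplus> l) \<otimes> b = (p \<otimes> a \<oplus> r \<otimes> b) \<oplus> (k \<otimes> a \<oplus> l \<otimes> b)"
    using c ck by algebra
  moreover have "(q \<oplus> m) \<otimes> a \<oplus> (s \<oplus> n) \<otimes> b = (q \<otimes> a \<oplus> s \<otimes> b) \<oplus> (m \<otimes> a \<oplus> n \<otimes> b)"
    using c ck by algebra
  ultimately show ?thesis
    using that[of "p \<oplus> k" "q \<oplus> m" "r \<oplus> l" "s \<oplus> n"] rel A c by (simp add: relation_def)
qed

end

section \<open>Lifting units\<close>

text \<open>By the equation \<open>one\<close>, the images of \<open>u\<close> and \<open>i\<close>
  generate the unit ideal. Stable rank 1 makes the image of \<open>u\<close> a unit after adding a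
  multiple of the image of \<open>i\<close>; the multiplier and the inverse are lifted along the
  surjection.\<close>

lemma (in ring_hom_cring) stable_rank_one_surjection_lift_unit:
  assumes sr: "stable_rank_one S" and surj: "h ` carrier R = carrier S"
    and u: "u \<in> carrier R" and x: "x \<in> carrier R" and i: "i \<in> carrier R"
    and one: "x \<otimes> u \<oplus> i = \<one>"
  obtains r w where "r \<in> carrier R" "w \<in> carrier R" "h ((u \<oplus> r \<otimes> i) \<otimes> w) = \<one>\<^bsub>S\<^esub>"
proof -
  have "PIdl\<^bsub>S\<^esub> (h u) <+>\<^bsub>S\<^esub> PIdl\<^bsub>S\<^esub> (h i) = carrier S"
  proof (rule subset_antisym)
    show "PIdl\<^bsub>S\<^esub> (h u) <+>\<^bsub>S\<^esub> PIdl\<^bsub>S\<^esub> (h i) \<subseteq> carrier S"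
      using u i by (auto simp: cgenideal_def set_add_def')
    show "carrier S \<subseteq> PIdl\<^bsub>S\<^esub> (h u) <+>\<^bsub>S\<^esub> PIdl\<^bsub>S\<^esub> (h i)"
    proof
      fix s assume s: "s \<in> carrier S"
      have "s = s \<otimes>\<^bsub>S\<^esub> h (x \<otimes> u \<oplus> i)" unfolding one hom_one using s by (rule S.r_one[symmetric])
      also have "\<dots> = (s \<otimes>\<^bsub>S\<^esub> h x) \<otimes>\<^bsub>S\<^esub> h u \<oplus>\<^bsub>S\<^esub> s \<otimes>\<^bsub>S\<^esub> h i"
        using s u i x by (simp only: ring_hom_add[OF homh] hom_mult hom_closed S.r_distr S.m_assoc R.m_closed S.m_closed)
      finally have eq: "s = (s \<otimes>\<^bsub>S\<^esub> h x) \<otimes>\<^bsub>S\<^esub> h u \<oplus>\<^bsub>S\<^esub> s \<otimes>\<^bsub>S\<^esub> h i" .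
      have "s \<otimes>\<^bsub>S\<^esub> h x \<in> carrier S" using s x by simp
      then have "(s \<otimes>\<^bsub>S\<^esub> h x) \<otimes>\<^bsub>S\<^esub> h u \<in> PIdl\<^bsub>S\<^esub> (h u)" "s \<otimes>\<^bsub>S\<^esub> h i \<in> PIdl\<^bsub>S\<^esub> (h i)"
        using s unfolding cgenideal_def by blast+
      then have "(s \<otimes>\<^bsub>S\<^esub> h x) \<otimes>\<^bsub>S\<^esub> h u \<oplus>\<^bsub>S\<^esub> s \<otimes>\<^bsub>S\<^esub> h i \<in> PIdl\<^bsub>S\<^esub> (h u) <+>\<^bsub>S\<^esub> PIdl\<^bsub>S\<^esub> (h i)"
        unfolding set_add_def' by blast
      then show "s \<in> PIdl\<^bsub>S\<^esub> (h u) <+>\<^bsub>S\<^esub> PIdl\<^bsub>S\<^esub> (h i)" using eq by metis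
    qed
  qed
  then obtain r where r: "r \<in> carrier S" "h u \<oplus>\<^bsub>S\<^esub> r \<otimes>\<^bsub>S\<^esub> h i \<in> Units S"
    using sr u i unfolding stable_rank_one_def by (meson hom_closed)
  obtain r' where r': "r' \<in> carrier R" "r = h r'" using r(1) surj by blast
  obtain s where s: "s \<in> carrier S" "(h u \<oplus>\<^bsub>S\<^esub> r \<otimes>\<^bsub>S\<^esub> h i) \<otimes>\<^bsub>S\<^esub> s = \<one>\<^bsub>S\<^esub>"
    using r(2) unfolding Units_def by blast
  obtain w where w: "w \<in> carrier R" "s = h w" using s(1) surj by blast
  have "h ((u \<oplus> r' \<otimes> i) \<otimes> w) = \<one>\<^bsub>S\<^esub>" using s w r' u i
    by (simp only: ring_hom_add[OF homh] hom_mult hom_closed R.m_closed R.a_closed)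
  with r' w show ?thesis using that by blast
qed

text \<open>Working with the element 1 - x u of \<open>J\<close> ensures that the correction of
  \<open>u\<close> is a multiple of it and stays in \<open>J\<close>. So the class of
  \<open>u\<close> modulo \<open>J\<close> is kept, while \<open>u \<oplus> j\<close> becomes a unit
  modulo \<open>b\<close>, with inverse \<open>w\<close>.\<close>

lemma (in cring) stable_rank_one_lift_unit:
  assumes b: "b \<in> carrier R" and sr: "stable_rank_one (R Quot (PIdl b))"
    and J: "ideal J R" and u: "u \<in> carrier R" "x \<in> carrier R" and ux: "\<one> \<ominus> x \<otimes> u \<in> J"
  obtains j w t where "j \<in> J" "w \<in> carrier R" "t \<in> carrier R" "(u \<oplus> j) \<otimes> w \<oplus> t \<otimes> b = \<one>"
proof -
  define i where "i = \<one> \<ominus> x \<otimes> u"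
  have i: "i \<in> carrier R" "i \<in> J" using ux ideal.Icarr[OF J] by (auto simp: i_def)
  have one: "x \<otimes> u \<oplus> i = \<one>"
    unfolding i_def using u by algebra
  have N: "ideal (PIdl b) R" by (rule cgenideal_ideal[OF b])
  have surj: "(+>) (PIdl b) ` carrier R = carrier (R Quot (PIdl b))"
    unfolding FactRing_def A_RCOSETS_def' partial_object.simps by blast
  obtain r w where r: "r \<in> carrier R" and w: "w \<in> carrier R"
    and "PIdl b +> ((u \<oplus> r \<otimes> i) \<otimes> w) = \<one>\<^bsub>R Quot (PIdl b)\<^esub>"
    using ring_hom_cring.stable_rank_one_surjection_lift_unit
      [OF ideal.rcos_ring_hom_cring[OF N is_cring] sr surj u(1,2) i(1) one] by blast
  then have "PIdl b +> ((u \<oplus> r \<otimes> i) \<otimes> w) = PIdl b +> \<one>" by (simp add: FactRing_def)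
  \<comment> \<open>A coset contains its representative, so equality of the two cosets exhibits 1 as
    a multiple of \<open>b\<close> plus the product.\<close>
  moreover have "\<one> \<in> PIdl b +> \<one>"
    by (rule abelian_subgroup.a_rcos_self[OF _ one_closed])
       (intro abelian_subgroupI3 ideal.axioms(1)[OF N] abelian_group_axioms)
  ultimately have "\<one> \<in> PIdl b +> ((u \<oplus> r \<otimes> i) \<otimes> w)" by simp
  then obtain t where t: "t \<in> carrier R" "\<one> = t \<otimes> b \<oplus> (u \<oplus> r \<otimes> i) \<otimes> w"
    by (auto simp: cgenideal_def a_r_coset_def')
  have "(u \<oplus> r \<otimes> i) \<otimes> w \<oplus> t \<otimes> b = \<one>"
    unfolding t(2) using t(1) r u i w b by (intro a_comm) auto
  with w t r i show ?thesis using that[of "r \<otimes> i" w t] ideal.I_l_closed[OF J] by blast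
qed

section \<open>Submodules, quotient modules and free modules\<close>

text \<open>Negation is multiplication by -1, so closure under scalars already gives additive
  inverses.\<close>

lemma (in module) submoduleI':
  assumes "H \<subseteq> carrier M" "\<zero>\<^bsub>M\<^esub> \<in> H"
    and "\<And>x y. \<lbrakk>x \<in> H; y \<in> H\<rbrakk> \<Longrightarrow> x \<oplus>\<^bsub>M\<^esub> y \<in> H"
    and smult: "\<And>c x. \<lbrakk>c \<in> carrier R; x \<in> H\<rbrakk> \<Longrightarrow> c \<odot>\<^bsub>M\<^esub> x \<in> H"
  shows "submodule H R M"
proof (rule submoduleI[OF assms(1,2) _ assms(3,4)])
  fix x assume x: "x \<in> H"
  have "\<ominus>\<^bsub>M\<^esub> x = (\<ominus> \<one>) \<odot>\<^bsub>M\<^esub> x" using x assms(1) by (subst smult_l_minus) auto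
  then show "\<ominus>\<^bsub>M\<^esub> x \<in> H" using smult x by simp
qed

context module begin

lemma submodule_zero_closed:
  assumes "submodule N R M"
  shows "\<zero>\<^bsub>M\<^esub> \<in> N"
  using subgroup.one_closed[OF submodule.axioms(1)[OF assms]] by simp

lemma submodule_Inter:
  assumes "S \<noteq> {}" "\<And>N. N \<in> S \<Longrightarrow> submodule N R M"
  shows "submodule (\<Inter>S) R M"
proof (rule submoduleI')
  show "\<Inter>S \<subseteq> carrier M" using assms submoduleE(1) by blast
qed (use assms in \<open>auto intro: submodule_zero_closed submoduleE\<close>)

lemma generated_submodule_submodule:
  assumes "S \<subseteq> carrier M"
  shows "submodule (generated_submodule R M S) R M"
  unfolding generated_submodule_def
  using assms carrier_is_submodule by (intro submodule_Inter) auto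

lemma generated_submodule_subset: "S \<subseteq> generated_submodule R M S"
  by (auto simp: generated_submodule_def)

lemma generated_submodule_minimal:
  "\<lbrakk>submodule N R M; S \<subseteq> N\<rbrakk> \<Longrightarrow> generated_submodule R M S \<subseteq> N"
  by (auto simp: generated_submodule_def)

lemma generated_submodule_singleton:
  assumes x: "x \<in> carrier M"
  shows "generated_submodule R M {x} = {c \<odot>\<^bsub>M\<^esub> x | c. c \<in> carrier R}"
proof (rule subset_antisym)
  show "generated_submodule R M {x} \<subseteq> {c \<odot>\<^bsub>M\<^esub> x | c. c \<in> carrier R}"
  proof (intro generated_submodule_minimal submoduleI')
    show "\<zero>\<^bsub>M\<^esub> \<in> {c \<odot>\<^bsub>M\<^esub> x | c. c \<in> carrier R}"
      using smult_l_null[OF x] by (auto intro: exI[of _ \<zero>] simp: eq_commute)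
    show "{x} \<subseteq> {c \<odot>\<^bsub>M\<^esub> x | c. c \<in> carrier R}"
      using smult_one[OF x] by (auto intro: exI[of _ \<one>] simp: eq_commute)
    fix y z assume "y \<in> {c \<odot>\<^bsub>M\<^esub> x | c. c \<in> carrier R}" "z \<in> {c \<odot>\<^bsub>M\<^esub> x | c. c \<in> carrier R}"
    then obtain c d where "y = c \<odot>\<^bsub>M\<^esub> x" "c \<in> carrier R" "z = d \<odot>\<^bsub>M\<^esub> x" "d \<in> carrier R" by blast
    then show "y \<oplus>\<^bsub>M\<^esub> z \<in> {c \<odot>\<^bsub>M\<^esub> x | c. c \<in> carrier R}"
      using x smult_l_distr[of c d x] by (auto intro!: exI[of _ "c \<oplus> d"])
  next
    fix c y assume "c \<in> carrier R" "y \<in> {c \<odot>\<^bsub>M\<^esub> x | c. c \<in> carrier R}"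
    then obtain d where "y = d \<odot>\<^bsub>M\<^esub> x" "d \<in> carrier R" "c \<in> carrier R" by blast
    then show "c \<odot>\<^bsub>M\<^esub> y \<in> {c \<odot>\<^bsub>M\<^esub> x | c. c \<in> carrier R}"
      using x smult_assoc1[of c d x] by (auto intro!: exI[of _ "c \<otimes> d"])
  qed (use x in auto)
  show "{c \<odot>\<^bsub>M\<^esub> x | c. c \<in> carrier R} \<subseteq> generated_submodule R M {x}"
    using generated_submodule_subset[of "{x}"] submoduleE(4)[OF generated_submodule_submodule] x
    by auto
qed

lemma generated_submodule_pair:
  assumes xy: "x \<in> carrier M" "y \<in> carrier M"
  shows "generated_submodule R M {x, y} =
    {c \<odot>\<^bsub>M\<^esub> x \<oplus>\<^bsub>M\<^esub> d \<odot>\<^bsub>M\<^esub> y | c d. c \<in> carrier R \<and> d \<in> carrier R}" (is "_ = ?P")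
proof (rule subset_antisym)
  show "generated_submodule R M {x, y} \<subseteq> ?P"
  proof (intro generated_submodule_minimal submoduleI')
    have "\<zero>\<^bsub>M\<^esub> = \<zero> \<odot>\<^bsub>M\<^esub> x \<oplus>\<^bsub>M\<^esub> \<zero> \<odot>\<^bsub>M\<^esub> y" using xy by simp
    then show "\<zero>\<^bsub>M\<^esub> \<in> ?P" by blast
    have "x = \<one> \<odot>\<^bsub>M\<^esub> x \<oplus>\<^bsub>M\<^esub> \<zero> \<odot>\<^bsub>M\<^esub> y" "y = \<zero> \<odot>\<^bsub>M\<^esub> x \<oplus>\<^bsub>M\<^esub> \<one> \<odot>\<^bsub>M\<^esub> y" using xy by simp_all
    then show "{x, y} \<subseteq> ?P" by blast
    fix v w assume "v \<in> ?P" "w \<in> ?P"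
    then obtain c d c' d' where vw: "v = c \<odot>\<^bsub>M\<^esub> x \<oplus>\<^bsub>M\<^esub> d \<odot>\<^bsub>M\<^esub> y" "w = c' \<odot>\<^bsub>M\<^esub> x \<oplus>\<^bsub>M\<^esub> d' \<odot>\<^bsub>M\<^esub> y"
      and c: "c \<in> carrier R" "d \<in> carrier R" "c' \<in> carrier R" "d' \<in> carrier R"
      by blast
    have "v \<oplus>\<^bsub>M\<^esub> w = (c \<oplus> c') \<odot>\<^bsub>M\<^esub> x \<oplus>\<^bsub>M\<^esub> (d \<oplus> d') \<odot>\<^bsub>M\<^esub> y"
      unfolding vw using c xy by (simp add: smult_l_distr M.a_ac)
    then show "v \<oplus>\<^bsub>M\<^esub> w \<in> ?P" using c by blast
  next
    fix e v assume e: "e \<in> carrier R" and "v \<in> ?P"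
    then obtain c d where v: "v = c \<odot>\<^bsub>M\<^esub> x \<oplus>\<^bsub>M\<^esub> d \<odot>\<^bsub>M\<^esub> y"
      and c: "c \<in> carrier R" "d \<in> carrier R"
      by blast
    have "e \<odot>\<^bsub>M\<^esub> v = (e \<otimes> c) \<odot>\<^bsub>M\<^esub> x \<oplus>\<^bsub>M\<^esub> (e \<otimes> d) \<odot>\<^bsub>M\<^esub> y"
      unfolding v using c e xy by (simp add: smult_r_distr smult_assoc1)
    then show "e \<odot>\<^bsub>M\<^esub> v \<in> ?P" using c e by blast
  qed (use xy in auto)
  have "submodule (generated_submodule R M {x, y}) R M"
    using xy by (intro generated_submodule_submodule) simp
  note submoduleE(4,5)[OF this]
  then show "?P \<subseteq> generated_submodule R M {x, y}"
    using generated_submodule_subset[of "{x, y}"] by auto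
qed

lemma submodule_abelian_subgroup:
  assumes "submodule N R M"
  shows "abelian_subgroup N M"
  by (intro abelian_subgroupI3 additive_subgroup.intro submodule.axioms(1)[OF assms] M.abelian_group_axioms)

lemma quotient_module_carrier:
  "carrier (quotient_module R M N) = {N +>\<^bsub>M\<^esub> x | x. x \<in> carrier M}"
  by (auto simp: quotient_module_def A_RCOSETS_def')

lemma quotient_module_zero: "\<zero>\<^bsub>quotient_module R M N\<^esub> = N"
  by (simp add: quotient_module_def)

lemma quotient_module_add:
  assumes "submodule N R M" "x \<in> carrier M" "y \<in> carrier M"
  shows "(N +>\<^bsub>M\<^esub> x) \<oplus>\<^bsub>quotient_module R M N\<^esub> (N +>\<^bsub>M\<^esub> y) = N +>\<^bsub>M\<^esub> (x \<oplus>\<^bsub>M\<^esub> y)"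
  using abelian_subgroup.a_rcos_sum[OF submodule_abelian_subgroup] assms
  by (simp add: quotient_module_def)

lemma coset_eq_iff:
  assumes N: "submodule N R M" and xy: "x \<in> carrier M" "y \<in> carrier M"
  shows "N +>\<^bsub>M\<^esub> x = N +>\<^bsub>M\<^esub> y \<longleftrightarrow> x \<ominus>\<^bsub>M\<^esub> y \<in> N"
proof -
  interpret N: abelian_subgroup N M by (rule submodule_abelian_subgroup[OF N])
  show ?thesis
    using N.a_rcos_module[of y x] N.a_repr_independence'[of x y] N.a_rcos_self[of x] xy
    by (auto simp: a_minus_def)
qed

lemma coset_zero:
  assumes N: "submodule N R M"
  shows "N +>\<^bsub>M\<^esub> \<zero>\<^bsub>M\<^esub> = N"
  using submoduleE(1)[OF N] by (rule M.a_coset_add_zero)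

text \<open>The scalar multiple is defined as a union over all representatives of the coset. All of
  them contribute the same coset, and there is at least one.\<close>

lemma quotient_module_smult:
  assumes N: "submodule N R M" and c: "c \<in> carrier R" and x: "x \<in> carrier M"
  shows "c \<odot>\<^bsub>quotient_module R M N\<^esub> (N +>\<^bsub>M\<^esub> x) = N +>\<^bsub>M\<^esub> (c \<odot>\<^bsub>M\<^esub> x)"
proof -
  interpret N: abelian_subgroup N M by (rule submodule_abelian_subgroup[OF N])
  have "N +>\<^bsub>M\<^esub> (c \<odot>\<^bsub>M\<^esub> y) = N +>\<^bsub>M\<^esub> (c \<odot>\<^bsub>M\<^esub> x)" if y: "y \<in> N +>\<^bsub>M\<^esub> x" for y
  proof -
    have cy: "y \<in> carrier M" using N.a_elemrcos_carrier[OF x y] .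
    have "c \<odot>\<^bsub>M\<^esub> (y \<oplus>\<^bsub>M\<^esub> \<ominus>\<^bsub>M\<^esub> x) \<in> N"
      using submoduleE(4)[OF N c] N.a_rcos_module_imp[OF x y] by blast
    then have "c \<odot>\<^bsub>M\<^esub> y \<ominus>\<^bsub>M\<^esub> c \<odot>\<^bsub>M\<^esub> x \<in> N"
      using c x cy by (simp add: smult_r_distr smult_r_minus a_minus_def)
    then show ?thesis using coset_eq_iff[OF N] c x cy by simp
  qed
  then have "(\<Union>y\<in>N +>\<^bsub>M\<^esub> x. N +>\<^bsub>M\<^esub> (c \<odot>\<^bsub>M\<^esub> y)) = (\<Union>y\<in>N +>\<^bsub>M\<^esub> x. N +>\<^bsub>M\<^esub> (c \<odot>\<^bsub>M\<^esub> x))"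
    by (rule SUP_cong[OF refl])
  also have "\<dots> = N +>\<^bsub>M\<^esub> (c \<odot>\<^bsub>M\<^esub> x)" using N.a_rcos_self[OF x] by blast
  finally show ?thesis by (simp add: quotient_module_def)
qed

lemma quotient_module_module:
  assumes N: "submodule N R M"
  shows "module R (quotient_module R M N)"
proof -
  note simps = quotient_module_carrier quotient_module_zero quotient_module_add[OF N]
    quotient_module_smult[OF N]
  \<comment> \<open>With the zero of the quotient written as a coset, its neutrality reduces to
    addition of representatives.\<close>
  have zero: "N = N +>\<^bsub>M\<^esub> \<zero>\<^bsub>M\<^esub>" using coset_zero[OF N] by simp
  show ?thesis
  proof (rule moduleI[OF R.is_cring abelian_groupI])
    show "\<zero>\<^bsub>quotient_module R M N\<^esub> \<in> carrier (quotient_module R M N)"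
      unfolding simps using zero by blast
    fix X assume "X \<in> carrier (quotient_module R M N)"
    then obtain x where x: "x \<in> carrier M" "X = N +>\<^bsub>M\<^esub> x" unfolding simps by blast
    show "\<zero>\<^bsub>quotient_module R M N\<^esub> \<oplus>\<^bsub>quotient_module R M N\<^esub> X = X"
      unfolding quotient_module_zero x by (subst zero) (simp add: simps x)
    have "(N +>\<^bsub>M\<^esub> (\<ominus>\<^bsub>M\<^esub> x)) \<oplus>\<^bsub>quotient_module R M N\<^esub> X = \<zero>\<^bsub>quotient_module R M N\<^esub>"
      using x coset_zero[OF N] by (simp add: simps M.l_neg)
    then show "\<exists>Y\<in>carrier (quotient_module R M N). Y \<oplus>\<^bsub>quotient_module R M N\<^esub> X = \<zero>\<^bsub>quotient_module R M N\<^esub>"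
      using x by (intro bexI[of _ "N +>\<^bsub>M\<^esub> (\<ominus>\<^bsub>M\<^esub> x)"]) (auto simp: quotient_module_carrier)
  qed (auto simp: simps M.a_ac smult_l_distr smult_r_distr smult_assoc1)
qed

end

section \<open>Free modules and linear extension from a basis\<close>

lemma (in cring) free_module_simps:
  "\<zero>\<^bsub>free_module R X\<^esub> = (\<lambda>x. \<zero>)"
  "f \<oplus>\<^bsub>free_module R X\<^esub> g = (\<lambda>x. f x \<oplus> g x)"
  "c \<odot>\<^bsub>free_module R X\<^esub> f = (\<lambda>x. c \<otimes> f x)"
  by (simp_all add: free_module_def)

lemma (in cring) free_module_carrier:
  "f \<in> carrier (free_module R X) \<longleftrightarrow>
     (\<forall>x. f x \<in> carrier R) \<and> {x. f x \<noteq> \<zero>} \<subseteq> X \<and> finite {x. f x \<noteq> \<zero>}"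
  by (auto simp: free_module_def)

lemma (in cring) free_module_module: "module R (free_module R X)"
proof (rule moduleI[OF is_cring abelian_groupI])
  fix f g assume f: "f \<in> carrier (free_module R X)" and g: "g \<in> carrier (free_module R X)"
  have "{x. f x \<oplus> g x \<noteq> \<zero>} \<subseteq> {x. f x \<noteq> \<zero>} \<union> {x. g x \<noteq> \<zero>}" by auto
  with f g show "f \<oplus>\<^bsub>free_module R X\<^esub> g \<in> carrier (free_module R X)"
    unfolding free_module_simps free_module_carrier by (auto intro: finite_subset)
next
  fix c f assume c: "c \<in> carrier R" and f: "f \<in> carrier (free_module R X)"
  then have "{x. c \<otimes> f x \<noteq> \<zero>} \<subseteq> {x. f x \<noteq> \<zero>}" by auto
  with f c show "c \<odot>\<^bsub>free_module R X\<^esub> f \<in> carrier (free_module R X)"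
    unfolding free_module_simps free_module_carrier by (auto intro: finite_subset)
next
  fix f assume f: "f \<in> carrier (free_module R X)"
  then have "{x. \<ominus> f x \<noteq> \<zero>} \<subseteq> {x. f x \<noteq> \<zero>}" by (auto simp: free_module_carrier)
  with f have "(\<lambda>x. \<ominus> f x) \<in> carrier (free_module R X)"
    unfolding free_module_carrier by (auto intro: finite_subset)
  moreover have "(\<lambda>x. \<ominus> f x) \<oplus>\<^bsub>free_module R X\<^esub> f = \<zero>\<^bsub>free_module R X\<^esub>"
    using f by (auto simp: free_module_simps free_module_carrier l_neg)
  ultimately show "\<exists>g\<in>carrier (free_module R X). g \<oplus>\<^bsub>free_module R X\<^esub> f = \<zero>\<^bsub>free_module R X\<^esub>" by blast
qed (auto simp: free_module_simps free_module_carrier a_ac l_distr r_distr m_assoc)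

lemma (in cring) free_basis_carrier:
  assumes "x \<in> X"
  shows "free_basis R x \<in> carrier (free_module R X)"
  using assms by (auto simp: free_module_carrier free_basis_def)

text \<open>The basis spans: a finitely supported function is a finite combination of basis
  elements, by induction on a finite set containing its support.\<close>

lemma (in cring) free_module_induct:
  assumes H: "submodule H R (free_module R X)" and basis: "\<And>x. x \<in> X \<Longrightarrow> free_basis R x \<in> H"
  shows "H = carrier (free_module R X)"
proof
  let ?F = "free_module R X"
  interpret F: module R ?F by (rule free_module_module)
  show "H \<subseteq> carrier ?F" by (rule F.submoduleE(1)[OF H])
  have "f \<in> H" if "finite S" "f \<in> carrier ?F" "{x. f x \<noteq> \<zero>} \<subseteq> S" for S f
    using that
  proof (induction arbitrary: f)
    case empty
    then have "f = \<zero>\<^bsub>?F\<^esub>" by (auto simp: free_module_simps)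
    then show ?case using F.submodule_zero_closed[OF H] by simp
  next
    case (insert s S)
    note cf = insert.prems(1)[unfolded free_module_carrier]
    define g where "g = f (s := \<zero>)"
    have supp: "{x. g x \<noteq> \<zero>} \<subseteq> {x. f x \<noteq> \<zero>}" by (auto simp: g_def)
    have g: "g \<in> carrier ?F"
      using cf supp unfolding free_module_carrier by (auto intro: finite_subset simp: g_def)
    have gH: "g \<in> H" using insert.prems(2) by (intro insert.IH g) (auto simp: g_def)
    \<comment> \<open>If \<open>f s\<close> is zero, \<open>s\<close> may lie outside
      \<open>X\<close> and have no basis element in \<open>H\<close>, but then nothing was removed
      from \<open>f\<close>.\<close>
    show ?case
    proof (cases "f s = \<zero>")
      case True
      then have "g = f" by (auto simp: g_def)
      with gH show ?thesis by simp
    next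
      case False
      then have s: "s \<in> X" using cf by auto
      have "f s \<odot>\<^bsub>?F\<^esub> free_basis R s \<in> H" using F.submoduleE(4)[OF H] basis[OF s] cf by blast
      moreover have "f = g \<oplus>\<^bsub>?F\<^esub> f s \<odot>\<^bsub>?F\<^esub> free_basis R s"
        using cf by (auto simp: free_module_simps g_def free_basis_def)
      ultimately show ?thesis using F.submoduleE(5)[OF H gH] by metis
    qed
  qed
  then show "carrier ?F \<subseteq> H" by (auto simp: free_module_carrier)
qed

text \<open>The linear form on the free module with value \<open>D x\<close> at the basis element of
  \<open>x\<close>. Summing over the support keeps the sum finite for any set of basis
  indices.\<close>

definition (in cring) free_eval :: "('x \<Rightarrow> 'a) \<Rightarrow> ('x \<Rightarrow> 'a) \<Rightarrow> 'a" where
  "free_eval D f = (\<Oplus>x\<in>{x. f x \<noteq> \<zero>}. f x \<otimes> D x)"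

context cring begin

text \<open>Two functions and their sum have different supports; additivity needs all three sums
  over one common finite set.\<close>

lemma free_eval_superset:
  assumes D: "\<And>x. D x \<in> carrier R" and f: "\<And>x. f x \<in> carrier R"
    and S: "finite S" "{x. f x \<noteq> \<zero>} \<subseteq> S"
  shows "free_eval D f = (\<Oplus>x\<in>S. f x \<otimes> D x)"
  unfolding free_eval_def
  using assms by (intro add.finprod_mono_neutral_cong_left) (auto simp: D)

lemma free_eval_add:
  assumes D: "\<And>x. D x \<in> carrier R"
    and f: "f \<in> carrier (free_module R X)" and g: "g \<in> carrier (free_module R X)"
  shows "free_eval D (f \<oplus>\<^bsub>free_module R X\<^esub> g) = free_eval D f \<oplus> free_eval D g"
proof -
  let ?S = "{x. f x \<noteq> \<zero>} \<union> {x. g x \<noteq> \<zero>}"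
  have fin: "finite ?S" and c: "\<And>x. f x \<in> carrier R" "\<And>x. g x \<in> carrier R"
    using f g by (auto simp: free_module_carrier)
  have "free_eval D (\<lambda>x. f x \<oplus> g x) = (\<Oplus>x\<in>?S. (f x \<oplus> g x) \<otimes> D x)"
    using c by (intro free_eval_superset D fin) auto
  also have "\<dots> = (\<Oplus>x\<in>?S. f x \<otimes> D x \<oplus> g x \<otimes> D x)"
    using c D by (simp add: l_distr)
  also have "\<dots> = (\<Oplus>x\<in>?S. f x \<otimes> D x) \<oplus> (\<Oplus>x\<in>?S. g x \<otimes> D x)"
    using c D by (intro finsum_addf) auto
  also have "(\<Oplus>x\<in>?S. f x \<otimes> D x) = free_eval D f"
    using c by (intro free_eval_superset[symmetric] D fin) auto
  also have "(\<Oplus>x\<in>?S. g x \<otimes> D x) = free_eval D g"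
    using c by (intro free_eval_superset[symmetric] D fin) auto
  finally show ?thesis by (simp add: free_module_simps)
qed

lemma free_eval_smult:
  assumes D: "\<And>x. D x \<in> carrier R" and k: "k \<in> carrier R"
    and f: "f \<in> carrier (free_module R X)"
  shows "free_eval D (k \<odot>\<^bsub>free_module R X\<^esub> f) = k \<otimes> free_eval D f"
proof -
  let ?S = "{x. f x \<noteq> \<zero>}"
  have fin: "finite ?S" and c: "\<And>x. f x \<in> carrier R"
    using f by (auto simp: free_module_carrier)
  have "free_eval D (\<lambda>x. k \<otimes> f x) = (\<Oplus>x\<in>?S. (k \<otimes> f x) \<otimes> D x)"
    using c k by (intro free_eval_superset D fin) auto
  also have "\<dots> = (\<Oplus>x\<in>?S. k \<otimes> (f x \<otimes> D x))"
    using c D k by (simp add: m_assoc)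
  also have "\<dots> = k \<otimes> free_eval D f"
    unfolding free_eval_def using c D k by (intro finsum_rdistr[symmetric] fin) auto
  finally show ?thesis by (simp add: free_module_simps)
qed

lemma free_eval_basis:
  assumes D: "\<And>x. D x \<in> carrier R"
  shows "free_eval D (free_basis R x) = D x"
proof -
  have "free_eval D (free_basis R x) = (\<Oplus>y\<in>{x}. free_basis R x y \<otimes> D y)"
    by (intro free_eval_superset D) (auto simp: free_basis_def)
  also have "\<dots> = D x" using D by (simp add: free_basis_def)
  finally show ?thesis .
qed

lemma free_eval_zero: "free_eval D \<zero>\<^bsub>free_module R X\<^esub> = \<zero>"
  by (simp add: free_eval_def free_module_simps)

text \<open>This is the kernel of the induced map to R / J, expressed without the quotient. A
  generated submodule lies in it as soon as its generators do.\<close>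

lemma free_eval_preimage_submodule:
  assumes D: "\<And>x. D x \<in> carrier R" and J: "ideal J R"
  shows "submodule {f \<in> carrier (free_module R X). free_eval D f \<in> J} R (free_module R X)"
proof -
  interpret F: module R "free_module R X" by (rule free_module_module)
  interpret J: ideal J R by (rule J)
  show ?thesis
    by (rule F.submoduleI')
       (auto simp: free_eval_add[OF D] free_eval_smult[OF D] free_eval_zero intro: J.I_l_closed)
qed

end

section \<open>The exterior square\<close>

context module begin

lemma exterior_relators_subset:
  "exterior_relators R M \<subseteq> carrier (free_module R (carrier M \<times> carrier M))"
proof -
  interpret F: module R "free_module R (carrier M \<times> carrier M)" by (rule R.free_module_module)
  have "free_basis R (x, y) \<in> carrier (free_module R (carrier M \<times> carrier M))"
    if "x \<in> carrier M" "y \<in> carrier M" for x y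
    using that by (intro R.free_basis_carrier) simp
  then show ?thesis
    unfolding exterior_relators_def Let_def
    by (intro Un_least subsetI; elim CollectE exE conjE; simp)
qed

lemma exterior_null_submodule:
  "submodule (exterior_null R M) R (free_module R (carrier M \<times> carrier M))"
  unfolding exterior_null_def
  by (rule module.generated_submodule_submodule[OF R.free_module_module exterior_relators_subset])

lemma exterior_relators_subset_null: "exterior_relators R M \<subseteq> exterior_null R M"
  unfolding exterior_null_def
  by (rule module.generated_submodule_subset[OF R.free_module_module])

lemma exterior_square_module: "module R (exterior_square R M)"
  unfolding exterior_square_def
  by (rule module.quotient_module_module[OF R.free_module_module exterior_null_submodule])

lemma free_basis_pair_carrier:
  "\<lbrakk>x \<in> carrier M; y \<in> carrier M\<rbrakk>
    \<Longrightarrow> free_basis R (x, y) \<in> carrier (free_module R (carrier M \<times> carrier M))"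
  by (intro R.free_basis_carrier) simp

lemma wedge_closed:
  "\<lbrakk>x \<in> carrier M; y \<in> carrier M\<rbrakk> \<Longrightarrow> wedge R M x y \<in> carrier (exterior_square R M)"
  using free_basis_pair_carrier[of x y]
  by (auto simp: exterior_square_def wedge_def module.quotient_module_carrier[OF R.free_module_module])

lemma wedge_self:
  assumes x: "x \<in> carrier M"
  shows "wedge R M x x = \<zero>\<^bsub>exterior_square R M\<^esub>"
proof -
  interpret N: abelian_subgroup "exterior_null R M" "free_module R (carrier M \<times> carrier M)"
    by (rule module.submodule_abelian_subgroup[OF R.free_module_module exterior_null_submodule])
  have "free_basis R (x, x) \<in> exterior_relators R M"
    using x unfolding exterior_relators_def Let_def by blast
  then have "free_basis R (x, x) \<in> exterior_null R M" using exterior_relators_subset_null by blast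
  then show ?thesis
    unfolding wedge_def exterior_square_def module.quotient_module_zero[OF R.free_module_module]
    by (rule N.a_rcos_const)
qed

text \<open>The relators for bilinearity are differences, and each identifies two cosets in this
  way. The four linearity laws of the wedge are instances.\<close>

lemma exterior_null_cosetI:
  assumes "f \<ominus>\<^bsub>free_module R (carrier M \<times> carrier M)\<^esub> g \<in> exterior_relators R M"
    and "f \<in> carrier (free_module R (carrier M \<times> carrier M))"
    and "g \<in> carrier (free_module R (carrier M \<times> carrier M))"
  shows "exterior_null R M +>\<^bsub>free_module R (carrier M \<times> carrier M)\<^esub> f
       = exterior_null R M +>\<^bsub>free_module R (carrier M \<times> carrier M)\<^esub> g"
  using module.coset_eq_iff[OF R.free_module_module exterior_null_submodule assms(2,3)]
    assms(1) exterior_relators_subset_null by blast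

lemmas exterior_coset_add =
  module.quotient_module_add[OF R.free_module_module exterior_null_submodule]
lemmas exterior_coset_smult =
  module.quotient_module_smult[OF R.free_module_module exterior_null_submodule]

lemma wedge_add_left:
  assumes "x \<in> carrier M" "y \<in> carrier M" "z \<in> carrier M"
  shows "wedge R M (x \<oplus>\<^bsub>M\<^esub> y) z = wedge R M x z \<oplus>\<^bsub>exterior_square R M\<^esub> wedge R M y z"
proof -
  interpret F: module R "free_module R (carrier M \<times> carrier M)" by (rule R.free_module_module)
  let ?F = "free_module R (carrier M \<times> carrier M)"
  have "free_basis R (x \<oplus>\<^bsub>M\<^esub> y, z) \<ominus>\<^bsub>?F\<^esub> (free_basis R (x, z) \<oplus>\<^bsub>?F\<^esub> free_basis R (y, z))
      \<in> exterior_relators R M"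
    unfolding exterior_relators_def Let_def using assms by blast
  from exterior_null_cosetI[OF this] show ?thesis
    using assms free_basis_pair_carrier
    by (simp add: wedge_def exterior_square_def exterior_coset_add)
qed

lemma wedge_add_right:
  assumes "x \<in> carrier M" "y \<in> carrier M" "z \<in> carrier M"
  shows "wedge R M x (y \<oplus>\<^bsub>M\<^esub> z) = wedge R M x y \<oplus>\<^bsub>exterior_square R M\<^esub> wedge R M x z"
proof -
  interpret F: module R "free_module R (carrier M \<times> carrier M)" by (rule R.free_module_module)
  let ?F = "free_module R (carrier M \<times> carrier M)"
  have "free_basis R (x, y \<oplus>\<^bsub>M\<^esub> z) \<ominus>\<^bsub>?F\<^esub> (free_basis R (x, y) \<oplus>\<^bsub>?F\<^esub> free_basis R (x, z))
      \<in> exterior_relators R M"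
    unfolding exterior_relators_def Let_def using assms by blast
  from exterior_null_cosetI[OF this] show ?thesis
    using assms free_basis_pair_carrier
    by (simp add: wedge_def exterior_square_def exterior_coset_add)
qed

lemma wedge_smult_left:
  assumes "c \<in> carrier R" "x \<in> carrier M" "y \<in> carrier M"
  shows "wedge R M (c \<odot>\<^bsub>M\<^esub> x) y = c \<odot>\<^bsub>exterior_square R M\<^esub> wedge R M x y"
proof -
  interpret F: module R "free_module R (carrier M \<times> carrier M)" by (rule R.free_module_module)
  let ?F = "free_module R (carrier M \<times> carrier M)"
  have "free_basis R (c \<odot>\<^bsub>M\<^esub> x, y) \<ominus>\<^bsub>?F\<^esub> c \<odot>\<^bsub>?F\<^esub> free_basis R (x, y) \<in> exterior_relators R M"
    unfolding exterior_relators_def Let_def using assms by blast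
  from exterior_null_cosetI[OF this] show ?thesis
    using assms free_basis_pair_carrier
    by (simp add: wedge_def exterior_square_def exterior_coset_smult)
qed

lemma wedge_smult_right:
  assumes "c \<in> carrier R" "x \<in> carrier M" "y \<in> carrier M"
  shows "wedge R M x (c \<odot>\<^bsub>M\<^esub> y) = c \<odot>\<^bsub>exterior_square R M\<^esub> wedge R M x y"
proof -
  interpret F: module R "free_module R (carrier M \<times> carrier M)" by (rule R.free_module_module)
  let ?F = "free_module R (carrier M \<times> carrier M)"
  have "free_basis R (x, c \<odot>\<^bsub>M\<^esub> y) \<ominus>\<^bsub>?F\<^esub> c \<odot>\<^bsub>?F\<^esub> free_basis R (x, y) \<in> exterior_relators R M"
    unfolding exterior_relators_def Let_def using assms by blast
  from exterior_null_cosetI[OF this] show ?thesis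
    using assms free_basis_pair_carrier
    by (simp add: wedge_def exterior_square_def exterior_coset_smult)
qed

text \<open>Expand (x + y) \<and> (x + y) = 0.\<close>

lemma wedge_swap:
  assumes xy: "x \<in> carrier M" "y \<in> carrier M"
  shows "wedge R M y x = \<ominus>\<^bsub>exterior_square R M\<^esub> wedge R M x y"
proof -
  interpret E: module R "exterior_square R M" by (rule exterior_square_module)
  have "wedge R M y x \<oplus>\<^bsub>exterior_square R M\<^esub> wedge R M x y = wedge R M (x \<oplus>\<^bsub>M\<^esub> y) (x \<oplus>\<^bsub>M\<^esub> y)"
    using xy wedge_closed
    by (simp add: wedge_add_left wedge_add_right wedge_self[OF xy(1)] wedge_self[OF xy(2)] E.a_comm)
  also have "\<dots> = \<zero>\<^bsub>exterior_square R M\<^esub>" using xy by (simp add: wedge_self)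
  finally show ?thesis using wedge_closed xy E.minus_equality by metis
qed

text \<open>In the bilinear expansion a \<and> a and b \<and> b vanish, and rewriting b \<and> a
  produces the sign in the determinant.\<close>

lemma wedge_determinant:
  assumes ab: "a \<in> carrier M" "b \<in> carrier M"
    and c: "p \<in> carrier R" "q \<in> carrier R" "r \<in> carrier R" "s \<in> carrier R"
  shows "wedge R M (p \<odot>\<^bsub>M\<^esub> a \<oplus>\<^bsub>M\<^esub> r \<odot>\<^bsub>M\<^esub> b) (q \<odot>\<^bsub>M\<^esub> a \<oplus>\<^bsub>M\<^esub> s \<odot>\<^bsub>M\<^esub> b)
    = (p \<otimes> s \<ominus> q \<otimes> r) \<odot>\<^bsub>exterior_square R M\<^esub> wedge R M a b"
proof -
  interpret E: module R "exterior_square R M" by (rule exterior_square_module)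
  let ?E = "exterior_square R M"
  let ?w = "wedge R M a b"
  have w: "?w \<in> carrier ?E" using wedge_closed ab by simp
  have "wedge R M (p \<odot>\<^bsub>M\<^esub> a \<oplus>\<^bsub>M\<^esub> r \<odot>\<^bsub>M\<^esub> b) (q \<odot>\<^bsub>M\<^esub> a \<oplus>\<^bsub>M\<^esub> s \<odot>\<^bsub>M\<^esub> b)
      = q \<odot>\<^bsub>?E\<^esub> (r \<odot>\<^bsub>?E\<^esub> (\<ominus>\<^bsub>?E\<^esub> ?w)) \<oplus>\<^bsub>?E\<^esub> s \<odot>\<^bsub>?E\<^esub> (p \<odot>\<^bsub>?E\<^esub> ?w)"
    using ab c w
    by (simp add: wedge_add_left wedge_add_right wedge_smult_left wedge_smult_right wedge_self
        wedge_swap[OF ab])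
  also have "\<dots> = (\<ominus> (q \<otimes> r)) \<odot>\<^bsub>?E\<^esub> ?w \<oplus>\<^bsub>?E\<^esub> (s \<otimes> p) \<odot>\<^bsub>?E\<^esub> ?w"
    using c w by (simp add: E.smult_assoc1 E.smult_r_minus E.smult_l_minus)
  also have "\<dots> = (p \<otimes> s \<ominus> q \<otimes> r) \<odot>\<^bsub>?E\<^esub> ?w"
    using c w by (simp add: E.smult_l_distr[symmetric] a_minus_def R.m_comm R.a_comm)
  finally show ?thesis .
qed

text \<open>The wedge of two combinations of \<open>a\<close> and \<open>b\<close> is a multiple of
  a \<and> b by \<open>wedge_determinant\<close>, and such wedges span the exterior square.\<close>

lemma exterior_square_cyclic:
  assumes ab: "a \<in> carrier M" "b \<in> carrier M"
    and gen: "generated_submodule R M {a, b} = carrier M"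
  shows "carrier (exterior_square R M)
    = {c \<odot>\<^bsub>exterior_square R M\<^esub> wedge R M a b | c. c \<in> carrier R}"
proof (rule subset_antisym)
  let ?E = "exterior_square R M"
  let ?F = "free_module R (carrier M \<times> carrier M)"
  let ?N = "exterior_null R M"
  let ?w = "wedge R M a b"
  interpret F: module R ?F by (rule R.free_module_module)
  interpret E: module R ?E by (rule exterior_square_module)
  have w: "?w \<in> carrier ?E" using wedge_closed ab by simp
  show "{c \<odot>\<^bsub>?E\<^esub> ?w | c. c \<in> carrier R} \<subseteq> carrier ?E" using w by auto
  \<comment> \<open>This is the preimage in the free module of the multiples of a \<and> b; being a
    submodule, it is everything once it contains the basis.\<close>
  define H where "H = {f \<in> carrier ?F. \<exists>c\<in>carrier R. ?N +>\<^bsub>?F\<^esub> f = c \<odot>\<^bsub>?E\<^esub> ?w}"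
  have "H = carrier ?F"
  proof (rule R.free_module_induct)
    show "submodule H R ?F"
    proof (rule F.submoduleI')
      have "?N +>\<^bsub>?F\<^esub> \<zero>\<^bsub>?F\<^esub> = \<zero>\<^bsub>?E\<^esub>"
        using F.coset_zero[OF exterior_null_submodule]
        by (simp add: exterior_square_def F.quotient_module_zero)
      also have "\<dots> = \<zero> \<odot>\<^bsub>?E\<^esub> ?w" using w by simp
      finally show "\<zero>\<^bsub>?F\<^esub> \<in> H" unfolding H_def by blast
    next
      fix f g assume "f \<in> H" "g \<in> H"
      then obtain c d where f: "f \<in> carrier ?F" "c \<in> carrier R" "?N +>\<^bsub>?F\<^esub> f = c \<odot>\<^bsub>?E\<^esub> ?w"
        and g: "g \<in> carrier ?F" "d \<in> carrier R" "?N +>\<^bsub>?F\<^esub> g = d \<odot>\<^bsub>?E\<^esub> ?w"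
        unfolding H_def by blast
      have "?N +>\<^bsub>?F\<^esub> (f \<oplus>\<^bsub>?F\<^esub> g) = (?N +>\<^bsub>?F\<^esub> f) \<oplus>\<^bsub>?E\<^esub> (?N +>\<^bsub>?F\<^esub> g)"
        using f(1) g(1) by (simp add: exterior_square_def exterior_coset_add)
      also have "\<dots> = (c \<oplus> d) \<odot>\<^bsub>?E\<^esub> ?w"
        unfolding f(3) g(3) using f(2) g(2) w by (simp add: E.smult_l_distr)
      finally show "f \<oplus>\<^bsub>?F\<^esub> g \<in> H"
        unfolding H_def using f(1,2) g(1,2) by blast
    next
      fix e f assume e: "e \<in> carrier R" and "f \<in> H"
      then obtain c where f: "f \<in> carrier ?F" "c \<in> carrier R" "?N +>\<^bsub>?F\<^esub> f = c \<odot>\<^bsub>?E\<^esub> ?w"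
        unfolding H_def by blast
      have "?N +>\<^bsub>?F\<^esub> (e \<odot>\<^bsub>?F\<^esub> f) = e \<odot>\<^bsub>?E\<^esub> (?N +>\<^bsub>?F\<^esub> f)"
        using f(1) e by (simp add: exterior_square_def exterior_coset_smult)
      also have "\<dots> = (e \<otimes> c) \<odot>\<^bsub>?E\<^esub> ?w"
        unfolding f(3) using f(2) e w by (simp add: E.smult_assoc1)
      finally show "e \<odot>\<^bsub>?F\<^esub> f \<in> H"
        unfolding H_def using f(1,2) e by blast
    qed (auto simp: H_def)
  next
    fix x assume "x \<in> carrier M \<times> carrier M"
    then obtain y z where x: "x = (y, z)" "y \<in> carrier M" "z \<in> carrier M" by blast
    obtain p r where y: "y = p \<odot>\<^bsub>M\<^esub> a \<oplus>\<^bsub>M\<^esub> r \<odot>\<^bsub>M\<^esub> b" "p \<in> carrier R" "r \<in> carrier R"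
      using x(2) unfolding gen[symmetric] generated_submodule_pair[OF ab] by blast
    obtain q s where z: "z = q \<odot>\<^bsub>M\<^esub> a \<oplus>\<^bsub>M\<^esub> s \<odot>\<^bsub>M\<^esub> b" "q \<in> carrier R" "s \<in> carrier R"
      using x(3) unfolding gen[symmetric] generated_submodule_pair[OF ab] by blast
    have "?N +>\<^bsub>?F\<^esub> free_basis R x = (p \<otimes> s \<ominus> q \<otimes> r) \<odot>\<^bsub>?E\<^esub> ?w"
      using wedge_determinant[OF ab y(2) z(2) y(3) z(3)] by (simp add: x(1) y(1) z(1) wedge_def)
    moreover have "p \<otimes> s \<ominus> q \<otimes> r \<in> carrier R" using y z by simp
    moreover have "free_basis R x \<in> carrier ?F" using free_basis_pair_carrier x by simp
    ultimately show "free_basis R x \<in> H" unfolding H_def by blast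
  qed
  then have mult: "\<exists>c\<in>carrier R. ?N +>\<^bsub>?F\<^esub> f = c \<odot>\<^bsub>?E\<^esub> ?w" if "f \<in> carrier ?F" for f
    using that unfolding H_def by blast
  show "carrier ?E \<subseteq> {c \<odot>\<^bsub>?E\<^esub> ?w | c. c \<in> carrier R}"
  proof
    fix X assume "X \<in> carrier ?E"
    then obtain f where X: "X = ?N +>\<^bsub>?F\<^esub> f" and f: "f \<in> carrier ?F"
      unfolding exterior_square_def F.quotient_module_carrier by blast
    show "X \<in> {c \<odot>\<^bsub>?E\<^esub> ?w | c. c \<in> carrier R}"
      unfolding X using mult[OF f] by blast
  qed
qed

text \<open>The universal property of the exterior square, for the bilinear alternating map
  induced by \<open>D\<close> with values in \<open>R / J\<close>.\<close>

lemma wedge_eq_smult_wedgeD: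
  assumes D: "\<And>u. D u \<in> carrier R" and J: "ideal J R"
    and add_left: "\<And>x y z. \<lbrakk>x \<in> carrier M; y \<in> carrier M; z \<in> carrier M\<rbrakk>
      \<Longrightarrow> D (x \<oplus>\<^bsub>M\<^esub> y, z) \<ominus> (D (x, z) \<oplus> D (y, z)) \<in> J"
    and add_right: "\<And>x y z. \<lbrakk>x \<in> carrier M; y \<in> carrier M; z \<in> carrier M\<rbrakk>
      \<Longrightarrow> D (x, y \<oplus>\<^bsub>M\<^esub> z) \<ominus> (D (x, y) \<oplus> D (x, z)) \<in> J"
    and smult_left: "\<And>c x y. \<lbrakk>c \<in> carrier R; x \<in> carrier M; y \<in> carrier M\<rbrakk>
      \<Longrightarrow> D (c \<odot>\<^bsub>M\<^esub> x, y) \<ominus> c \<otimes> D (x, y) \<in> J"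
    and smult_right: "\<And>c x y. \<lbrakk>c \<in> carrier R; x \<in> carrier M; y \<in> carrier M\<rbrakk>
      \<Longrightarrow> D (x, c \<odot>\<^bsub>M\<^esub> y) \<ominus> c \<otimes> D (x, y) \<in> J"
    and self: "\<And>x. x \<in> carrier M \<Longrightarrow> D (x, x) \<in> J"
    and xy: "x \<in> carrier M" "y \<in> carrier M" "z \<in> carrier M" "w \<in> carrier M" and c: "c \<in> carrier R"
    and eq: "wedge R M x y = c \<odot>\<^bsub>exterior_square R M\<^esub> wedge R M z w"
  shows "D (x, y) \<ominus> c \<otimes> D (z, w) \<in> J"
proof -
  let ?F = "free_module R (carrier M \<times> carrier M)"
  let ?H = "{f \<in> carrier ?F. R.free_eval D f \<in> J}"
  interpret F: module R ?F by (rule R.free_module_module)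
  have H: "submodule ?H R ?F" by (rule R.free_eval_preimage_submodule[OF D J])
  note carr = free_basis_pair_carrier
  note ev = R.free_eval_add[OF D, where X = "carrier M \<times> carrier M"]
    R.free_eval_smult[OF D, where X = "carrier M \<times> carrier M"] R.free_eval_basis[of D, OF D]
  have minus: "R.free_eval D (f \<ominus>\<^bsub>?F\<^esub> g) = R.free_eval D f \<ominus> R.free_eval D g"
    if f: "f \<in> carrier ?F" and g: "g \<in> carrier ?F" for f g
  proof -
    have eg: "R.free_eval D g \<in> carrier R"
      using g D by (auto simp: R.free_eval_def R.free_module_carrier intro!: R.finsum_closed)
    have "f \<ominus>\<^bsub>?F\<^esub> g = f \<oplus>\<^bsub>?F\<^esub> (\<ominus> \<one>) \<odot>\<^bsub>?F\<^esub> g"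
      using g by (simp add: a_minus_def F.smult_l_minus)
    then show ?thesis using f g eg by (simp add: ev R.l_minus a_minus_def)
  qed
  \<comment> \<open>The hypotheses on \<open>D\<close> say that its linear extension sends each of
    the five kinds of relators into \<open>J\<close>.\<close>
  have "exterior_relators R M \<subseteq> ?H"
  proof
    fix f assume f: "f \<in> exterior_relators R M"
    then have "R.free_eval D f \<in> J"
      unfolding exterior_relators_def Let_def
      by (elim UnE CollectE exE conjE)
         (simp_all add: minus ev carr add_left add_right smult_left smult_right self)
    then show "f \<in> ?H" using f exterior_relators_subset by blast
  qed
  then have null: "exterior_null R M \<subseteq> ?H"
    unfolding exterior_null_def by (rule F.generated_submodule_minimal[OF H])
  \<comment> \<open>Equality in the exterior square means that the difference of representatives
    lies in the null submodule, which the linear extension of \<open>D\<close> maps into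
    \<open>J\<close>.\<close>
  have "exterior_null R M +>\<^bsub>?F\<^esub> free_basis R (x, y)
      = exterior_null R M +>\<^bsub>?F\<^esub> (c \<odot>\<^bsub>?F\<^esub> free_basis R (z, w))"
    using eq c carr[OF xy(3,4)] by (simp add: wedge_def exterior_square_def exterior_coset_smult)
  then have "free_basis R (x, y) \<ominus>\<^bsub>?F\<^esub> c \<odot>\<^bsub>?F\<^esub> free_basis R (z, w) \<in> exterior_null R M"
    using F.coset_eq_iff[OF exterior_null_submodule] carr xy c by simp
  then have "R.free_eval D (free_basis R (x, y) \<ominus>\<^bsub>?F\<^esub> c \<odot>\<^bsub>?F\<^esub> free_basis R (z, w)) \<in> J"
    using null by blast
  then show ?thesis using carr xy c by (simp add: minus ev)
qed

end

section \<open>Generating pairs of an ideal\<close>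

lemma ideal_module_simps [simp]:
  "carrier (ideal_module R I) = I" "\<zero>\<^bsub>ideal_module R I\<^esub> = \<zero>\<^bsub>R\<^esub>"
  "x \<oplus>\<^bsub>ideal_module R I\<^esub> y = x \<oplus>\<^bsub>R\<^esub> y" "c \<odot>\<^bsub>ideal_module R I\<^esub> x = c \<otimes>\<^bsub>R\<^esub> x"
  by (simp_all add: ideal_module_def)

context cring begin

lemma ideal_module_module:
  assumes "ideal I R"
  shows "module R (ideal_module R I)"
proof -
  interpret ideal I R by (rule assms)
  note [simp] = a_Hcarr
  show ?thesis
  proof (rule moduleI[OF is_cring abelian_groupI])
    fix x assume "x \<in> carrier (ideal_module R I)"
    then have "\<ominus> x \<in> I" "\<ominus> x \<oplus> x = \<zero>" by (simp_all add: l_neg)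
    then show "\<exists>y\<in>carrier (ideal_module R I). y \<oplus>\<^bsub>ideal_module R I\<^esub> x = \<zero>\<^bsub>ideal_module R I\<^esub>"
      by auto
  qed (simp_all add: a_ac l_distr r_distr m_assoc I_l_closed)
qed

text \<open>Only one inclusion is stated, since combinations of elements of an ideal stay in
  it.\<close>

definition ideal_pair :: "'a set \<Rightarrow> 'a \<Rightarrow> 'a \<Rightarrow> bool" where
  "ideal_pair I a b \<longleftrightarrow> a \<in> I \<and> b \<in> I \<and>
     (\<forall>x\<in>I. \<exists>c\<in>carrier R. \<exists>d\<in>carrier R. x = c \<otimes> a \<oplus> d \<otimes> b)"

lemma generated_submodule_ideal_module:
  assumes I: "ideal I R" and ab: "a \<in> I" "b \<in> I"
  shows "generated_submodule R (ideal_module R I) {a, b} = I \<longleftrightarrow> ideal_pair I a b"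
proof -
  interpret M: module R "ideal_module R I" by (rule ideal_module_module[OF I])
  have "generated_submodule R (ideal_module R I) {a, b} \<subseteq> I"
    using M.submoduleE(1)[OF M.generated_submodule_submodule, of "{a, b}"] ab by simp
  moreover have gen: "generated_submodule R (ideal_module R I) {a, b}
      = {c \<otimes> a \<oplus> d \<otimes> b | c d. c \<in> carrier R \<and> d \<in> carrier R}"
    using M.generated_submodule_pair[of a b] ab by simp
  ultimately have "generated_submodule R (ideal_module R I) {a, b} = I \<longleftrightarrow>
      I \<subseteq> {c \<otimes> a \<oplus> d \<otimes> b | c d. c \<in> carrier R \<and> d \<in> carrier R}" by blast
  also have "\<dots> \<longleftrightarrow> ideal_pair I a b"
    unfolding ideal_pair_def using ab by (simp add: subset_iff) blast
  finally show ?thesis .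
qed

lemma generating_tuples_ideal_module:
  assumes I: "ideal I R"
  shows "generating_tuples R (ideal_module R I) 2 = {[a, b] | a b. ideal_pair I a b}"
proof (rule subset_antisym; rule subsetI)
  fix v assume v: "v \<in> generating_tuples R (ideal_module R I) 2"
  then obtain a b where "v = [a, b]"
    by (auto simp: generating_tuples_def length_Suc_conv numeral_2_eq_2)
  with v show "v \<in> {[a, b] | a b. ideal_pair I a b}"
    using generated_submodule_ideal_module[OF I, of a b] by (simp add: generating_tuples_def)
next
  fix v assume "v \<in> {[a, b] | a b. ideal_pair I a b}"
  then obtain a b where v: "v = [a, b]" "ideal_pair I a b" by blast
  then have "a \<in> I" "b \<in> I" by (simp_all add: ideal_pair_def)
  with v show "v \<in> generating_tuples R (ideal_module R I) 2"
    using generated_submodule_ideal_module[OF I, of a b] by (simp add: generating_tuples_def)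
qed

section \<open>The annihilator of the wedge of a generating pair\<close>

text \<open>Coefficient matrices with the same product with (a, b) have columns that differ by
  relations. So the determinant of the coefficients of two elements is well defined modulo the
  relation ideal.\<close>

lemma determinant_diff_relation_ideal:
  assumes ab: "a \<in> carrier R" "b \<in> carrier R"
    and c: "p \<in> carrier R" "q \<in> carrier R" "r \<in> carrier R" "s \<in> carrier R"
    and c': "p' \<in> carrier R" "q' \<in> carrier R" "r' \<in> carrier R" "s' \<in> carrier R"
    and eq: "p \<otimes> a \<oplus> r \<otimes> b = p' \<otimes> a \<oplus> r' \<otimes> b" "q \<otimes> a \<oplus> s \<otimes> b = q' \<otimes> a \<oplus> s' \<otimes> b"
  shows "(p \<otimes> s \<ominus> q \<otimes> r) \<ominus> (p' \<otimes> s' \<ominus> q' \<otimes> r') \<in> relation_ideal a b"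
proof -
  interpret J: ideal "relation_ideal a b" R by (rule relation_ideal_ideal)
  note 1 = relation_imp_relation_ideal[OF relation_diff[OF ab c(1,3) c'(1,3) eq(1)]]
  note 2 = relation_imp_relation_ideal[OF relation_diff[OF ab c(2,4) c'(2,4) eq(2)]]
  \<comment> \<open>The first bracket accounts for replacing the first column while the second is
    kept, the second bracket for replacing the second column afterwards.\<close>
  have "(p \<otimes> s \<ominus> q \<otimes> r) \<ominus> (p' \<otimes> s' \<ominus> q' \<otimes> r')
      = (s \<otimes> (p \<ominus> p') \<oplus> \<ominus> q \<otimes> (r \<ominus> r')) \<oplus> (p' \<otimes> (s \<ominus> s') \<oplus> \<ominus> r' \<otimes> (q \<ominus> q'))"
    using c c' by algebra
  also have "\<dots> \<in> relation_ideal a b"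
    using 1 2 c c' by (intro J.a_closed J.I_l_closed) auto
  finally show ?thesis .
qed

text \<open>Sending x \<and> y to the determinant of the coefficients of \<open>x\<close> and
  \<open>y\<close> is a linear map from the exterior square to the quotient by the relation ideal.
  It maps a \<and> b to 1, so a scalar that fixes a \<and> b is 1 there.\<close>

lemma wedge_eq_smult_self_imp_relation_ideal:
  assumes I: "ideal I R" and ab: "ideal_pair I a b" and k: "k \<in> carrier R"
    and eq: "wedge R (ideal_module R I) a b
      = k \<odot>\<^bsub>exterior_square R (ideal_module R I)\<^esub> wedge R (ideal_module R I) a b"
  shows "\<one> \<ominus> k \<in> relation_ideal a b"
proof -
  interpret M: module R "ideal_module R I" by (rule ideal_module_module[OF I])
  interpret J: ideal "relation_ideal a b" R by (rule relation_ideal_ideal)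
  have I_carr: "\<And>x. x \<in> I \<Longrightarrow> x \<in> carrier R" using ideal.Icarr[OF I] .
  have abI: "a \<in> I" "b \<in> I" using ab by (auto simp: ideal_pair_def)
  note abR = abI[THEN I_carr]
  \<comment> \<open>The chosen coefficients need not be linear in \<open>x\<close>; the defects are
    relations.\<close>
  obtain f g where fg: "\<And>x. x \<in> I \<Longrightarrow> f x \<in> carrier R" "\<And>x. x \<in> I \<Longrightarrow> g x \<in> carrier R"
    "\<And>x. x \<in> I \<Longrightarrow> x = f x \<otimes> a \<oplus> g x \<otimes> b"
    using ab unfolding ideal_pair_def by metis
  define D where "D = (\<lambda>(x, y). if x \<in> I \<and> y \<in> I then f x \<otimes> g y \<ominus> f y \<otimes> g x else \<zero>)"
  have D_carr: "D u \<in> carrier R" for u using fg by (auto simp: D_def split: prod.split)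
  \<comment> \<open>Modulo the relation ideal, \<open>D\<close> can be computed from any
    coefficients. For bilinearity, sums and multiples of the chosen ones are used.\<close>
  have D_in: "D (x, y) \<ominus> e \<in> relation_ideal a b"
    if xy: "x \<in> I" "y \<in> I" and c: "p \<in> carrier R" "q \<in> carrier R" "r \<in> carrier R" "s \<in> carrier R"
      and x: "x = p \<otimes> a \<oplus> r \<otimes> b" and y: "y = q \<otimes> a \<oplus> s \<otimes> b" and e: "e = p \<otimes> s \<ominus> q \<otimes> r"
    for x y p q r s e
  proof -
    have "f x \<otimes> a \<oplus> g x \<otimes> b = p \<otimes> a \<oplus> r \<otimes> b" "f y \<otimes> a \<oplus> g y \<otimes> b = q \<otimes> a \<oplus> s \<otimes> b"
      by (rule trans[OF fg(3)[OF xy(1), symmetric] x]) (rule trans[OF fg(3)[OF xy(2), symmetric] y])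
    from determinant_diff_relation_ideal[OF abR fg(1)[OF xy(1)] fg(1)[OF xy(2)]
        fg(2)[OF xy(1)] fg(2)[OF xy(2)] c this]
    show ?thesis using xy e by (simp add: D_def)
  qed
  have D_eq: "D (x, y) = f x \<otimes> g y \<ominus> f y \<otimes> g x" if "x \<in> I" "y \<in> I" for x y
    using that by (simp add: D_def)
  have "D (a, b) \<ominus> k \<otimes> D (a, b) \<in> relation_ideal a b"
  proof (rule M.wedge_eq_smult_wedgeD[OF D_carr relation_ideal_ideal _ _ _ _ _ _ _ _ _ k eq])
    fix x y z assume "x \<in> carrier (ideal_module R I)" "y \<in> carrier (ideal_module R I)"
      "z \<in> carrier (ideal_module R I)"
    then have xyz: "x \<in> I" "y \<in> I" "z \<in> I" by simp_all
    note c = xyz[THEN fg(1)] xyz[THEN fg(2)]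
    show "D (x \<oplus>\<^bsub>ideal_module R I\<^esub> y, z) \<ominus> (D (x, z) \<oplus> D (y, z)) \<in> relation_ideal a b"
    proof (rule D_in[of _ _ "f x \<oplus> f y" "f z" "g x \<oplus> g y" "g z"])
      have "(f x \<oplus> f y) \<otimes> a \<oplus> (g x \<oplus> g y) \<otimes> b = (f x \<otimes> a \<oplus> g x \<otimes> b) \<oplus> (f y \<otimes> a \<oplus> g y \<otimes> b)"
        using c abR by algebra
      then show "x \<oplus>\<^bsub>ideal_module R I\<^esub> y = (f x \<oplus> f y) \<otimes> a \<oplus> (g x \<oplus> g y) \<otimes> b"
        using fg(3)[OF xyz(1)] fg(3)[OF xyz(2)] by simp
      show "D (x, z) \<oplus> D (y, z) = (f x \<oplus> f y) \<otimes> g z \<ominus> f z \<otimes> (g x \<oplus> g y)"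
        unfolding D_eq[OF xyz(1,3)] D_eq[OF xyz(2,3)] using c by algebra
    qed (use xyz c fg(3) M.a_closed[of x y] in auto)
    show "D (x, y \<oplus>\<^bsub>ideal_module R I\<^esub> z) \<ominus> (D (x, y) \<oplus> D (x, z)) \<in> relation_ideal a b"
    proof (rule D_in[of _ _ "f x" "f y \<oplus> f z" "g x" "g y \<oplus> g z"])
      have "(f y \<oplus> f z) \<otimes> a \<oplus> (g y \<oplus> g z) \<otimes> b = (f y \<otimes> a \<oplus> g y \<otimes> b) \<oplus> (f z \<otimes> a \<oplus> g z \<otimes> b)"
        using c abR by algebra
      then show "y \<oplus>\<^bsub>ideal_module R I\<^esub> z = (f y \<oplus> f z) \<otimes> a \<oplus> (g y \<oplus> g z) \<otimes> b"
        using fg(3)[OF xyz(2)] fg(3)[OF xyz(3)] by simp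
      show "D (x, y) \<oplus> D (x, z) = f x \<otimes> (g y \<oplus> g z) \<ominus> (f y \<oplus> f z) \<otimes> g x"
        unfolding D_eq[OF xyz(1,2)] D_eq[OF xyz(1,3)] using c by algebra
    qed (use xyz c fg(3) M.a_closed[of y z] in auto)
  next
    fix e x y assume e: "e \<in> carrier R"
      and "x \<in> carrier (ideal_module R I)" "y \<in> carrier (ideal_module R I)"
    then have xy: "x \<in> I" "y \<in> I" by simp_all
    note c = xy[THEN fg(1)] xy[THEN fg(2)]
    show "D (e \<odot>\<^bsub>ideal_module R I\<^esub> x, y) \<ominus> e \<otimes> D (x, y) \<in> relation_ideal a b"
    proof (rule D_in[of _ _ "e \<otimes> f x" "f y" "e \<otimes> g x" "g y"])
      have "(e \<otimes> f x) \<otimes> a \<oplus> (e \<otimes> g x) \<otimes> b = e \<otimes> (f x \<otimes> a \<oplus> g x \<otimes> b)"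
        using c abR e by algebra
      then show "e \<odot>\<^bsub>ideal_module R I\<^esub> x = (e \<otimes> f x) \<otimes> a \<oplus> (e \<otimes> g x) \<otimes> b"
        using fg(3)[OF xy(1)] by simp
      show "e \<otimes> D (x, y) = (e \<otimes> f x) \<otimes> g y \<ominus> f y \<otimes> (e \<otimes> g x)"
        unfolding D_eq[OF xy] using c e by algebra
    qed (use xy c e fg(3) M.smult_closed[of e x] in auto)
    show "D (x, e \<odot>\<^bsub>ideal_module R I\<^esub> y) \<ominus> e \<otimes> D (x, y) \<in> relation_ideal a b"
    proof (rule D_in[of _ _ "f x" "e \<otimes> f y" "g x" "e \<otimes> g y"])
      have "(e \<otimes> f y) \<otimes> a \<oplus> (e \<otimes> g y) \<otimes> b = e \<otimes> (f y \<otimes> a \<oplus> g y \<otimes> b)"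
        using c abR e by algebra
      then show "e \<odot>\<^bsub>ideal_module R I\<^esub> y = (e \<otimes> f y) \<otimes> a \<oplus> (e \<otimes> g y) \<otimes> b"
        using fg(3)[OF xy(2)] by simp
      show "e \<otimes> D (x, y) = f x \<otimes> (e \<otimes> g y) \<ominus> (e \<otimes> f y) \<otimes> g x"
        unfolding D_eq[OF xy] using c e by algebra
    qed (use xy c e fg(3) M.smult_closed[of e y] in auto)
  next
    fix x assume "x \<in> carrier (ideal_module R I)"
    then have x: "x \<in> I" by simp
    have "D (x, x) = \<zero>" using D_eq[OF x x] fg(1,2)[OF x] by (simp add: r_neg a_minus_def)
    then show "D (x, x) \<in> relation_ideal a b" using J.zero_closed by simp
  qed (use abI in auto)
  \<comment> \<open>The chosen coefficients of \<open>a\<close> and \<open>b\<close> may differ from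
    the unit vectors, so \<open>D (a, b)\<close> is 1 only modulo the relation ideal. Adding a
    multiple of this congruence replaces \<open>D (a, b)\<close> by 1.\<close>
  moreover have "D (a, b) \<ominus> \<one> \<in> relation_ideal a b"
    using abI abR by (intro D_in[of _ _ \<one> \<zero> \<zero> \<one>]) (auto simp: a_minus_def)
  then have "(\<ominus> \<one> \<oplus> k) \<otimes> (D (a, b) \<ominus> \<one>) \<in> relation_ideal a b"
    using k by (intro J.I_l_closed) auto
  ultimately have "(D (a, b) \<ominus> k \<otimes> D (a, b)) \<oplus> (\<ominus> \<one> \<oplus> k) \<otimes> (D (a, b) \<ominus> \<one>) \<in> relation_ideal a b"
    by (rule J.a_closed)
  moreover have "(d \<ominus> k \<otimes> d) \<oplus> (\<ominus> \<one> \<oplus> k) \<otimes> (d \<ominus> \<one>) = \<one> \<ominus> k" if "d \<in> carrier R" for d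
    using that k by algebra
  ultimately show ?thesis using D_carr by metis
qed

text \<open>For a relation, k (a \<and> b) = (k a + l b) \<and> b = 0 and l (a \<and> b) = a \<and>
  (k a + l b) = 0. The scalars killing a \<and> b form an ideal, which thus contains the relation
  ideal.\<close>

lemma relation_ideal_annihilates_wedge:
  assumes I: "ideal I R" and ab: "a \<in> I" "b \<in> I" and j: "j \<in> relation_ideal a b"
  shows "j \<odot>\<^bsub>exterior_square R (ideal_module R I)\<^esub> wedge R (ideal_module R I) a b
    = \<zero>\<^bsub>exterior_square R (ideal_module R I)\<^esub>"
proof -
  interpret M: module R "ideal_module R I" by (rule ideal_module_module[OF I])
  let ?E = "exterior_square R (ideal_module R I)"
  let ?w = "wedge R (ideal_module R I) a b"
  interpret E: module R ?E by (rule M.exterior_square_module)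
  have w: "\<And>x y. x \<in> I \<Longrightarrow> y \<in> I \<Longrightarrow> wedge R (ideal_module R I) x y \<in> carrier ?E"
    using M.wedge_closed by simp
  have zero: "\<zero> \<in> I" using M.zero_closed by simp
  have wz: "wedge R (ideal_module R I) \<zero> y = \<zero>\<^bsub>?E\<^esub>" "wedge R (ideal_module R I) y \<zero> = \<zero>\<^bsub>?E\<^esub>"
    if y: "y \<in> I" for y
    using M.wedge_smult_left[of \<zero> \<zero> y] M.wedge_smult_right[of \<zero> y \<zero>] zero y w by simp_all
  define A where "A = {j \<in> carrier R. j \<odot>\<^bsub>?E\<^esub> ?w = \<zero>\<^bsub>?E\<^esub>}"
  have "ideal A R"
  proof (rule idealI[OF ring_axioms])
    show "subgroup A (add_monoid R)"
      using w[OF ab]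
      by (intro add.subgroupI) (auto simp: A_def E.smult_l_distr E.smult_l_minus a_inv_def[symmetric])
    fix x i assume i: "i \<in> A" and x: "x \<in> carrier R"
    then show "x \<otimes> i \<in> A" using w[OF ab] by (simp add: A_def E.smult_assoc1)
    then show "i \<otimes> x \<in> A" using i x by (simp add: m_comm A_def)
  qed
  moreover have "k \<in> A \<and> l \<in> A" if kl: "relation a b k l" for k l
  proof -
    note c = relation_carrier[OF kl] and abR = ab[THEN ideal.Icarr[OF I]]
    have eq: "k \<otimes> a \<oplus> l \<otimes> b = \<zero>" using kl by (simp add: relation_def)
    have "k \<odot>\<^bsub>?E\<^esub> ?w = \<zero>\<^bsub>?E\<^esub>"
      using M.wedge_determinant[of a b k \<zero> l \<one>] ab abR c wz(1)[OF ab(2)]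
      by (simp add: eq a_minus_def)
    moreover have "l \<odot>\<^bsub>?E\<^esub> ?w = \<zero>\<^bsub>?E\<^esub>"
      using M.wedge_determinant[of a b \<one> k \<zero> l] ab abR c wz(2)[OF ab(1)]
      by (simp add: eq a_minus_def)
    ultimately show ?thesis using c by (simp add: A_def)
  qed
  ultimately have "relation_ideal a b \<subseteq> A"
    unfolding relation_ideal_def by (intro genideal_minimal) blast+
  then show ?thesis using j by (auto simp: A_def)
qed

section \<open>The action of SL2 on generating pairs\<close>

lemma SL2_row_action_one:
  assumes "ideal I R" "a \<in> I" "b \<in> I"
  shows "\<one>\<^bsub>SL2 R\<^esub> \<in> carrier (SL2 R)" "row_action (ideal_module R I) \<one>\<^bsub>SL2 R\<^esub> [a, b] = [a, b]"
  using assms ideal.Icarr[OF assms(1)] by (simp_all add: SL2_def row_action_def a_minus_def)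

text \<open>Multiplicativity of the determinant.\<close>

lemma SL2_mult_closed:
  assumes g: "g \<in> carrier (SL2 R)" and h: "h \<in> carrier (SL2 R)"
  shows "g \<otimes>\<^bsub>SL2 R\<^esub> h \<in> carrier (SL2 R)"
proof -
  obtain p q r s where gd: "g = (p, q, r, s)" by (cases g)
  obtain p' q' r' s' where hd: "h = (p', q', r', s')" by (cases h)
  have c: "p \<in> carrier R" "q \<in> carrier R" "r \<in> carrier R" "s \<in> carrier R"
    and d: "p \<otimes> s \<ominus> q \<otimes> r = \<one>" using g by (auto simp: gd SL2_def)
  have c': "p' \<in> carrier R" "q' \<in> carrier R" "r' \<in> carrier R" "s' \<in> carrier R"
    and d': "p' \<otimes> s' \<ominus> q' \<otimes> r' = \<one>" using h by (auto simp: hd SL2_def)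
  have "(p \<otimes> p' \<oplus> q \<otimes> r') \<otimes> (r \<otimes> q' \<oplus> s \<otimes> s') \<ominus> (p \<otimes> q' \<oplus> q \<otimes> s') \<otimes> (r \<otimes> p' \<oplus> s \<otimes> r')
      = (p \<otimes> s \<ominus> q \<otimes> r) \<otimes> (p' \<otimes> s' \<ominus> q' \<otimes> r')"
    using c c' by algebra
  then show ?thesis using c c' d d' by (simp add: gd hd SL2_def)
qed

text \<open>The order of the factors is that of a right action: \<open>g\<close> acts first.\<close>

lemma row_action_mult:
  assumes I: "ideal I R" and ab: "a \<in> I" "b \<in> I"
    and g: "g \<in> carrier (SL2 R)" and h: "h \<in> carrier (SL2 R)"
  shows "row_action (ideal_module R I) h (row_action (ideal_module R I) g [a, b])
    = row_action (ideal_module R I) (g \<otimes>\<^bsub>SL2 R\<^esub> h) [a, b]"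
proof -
  obtain p q r s where gd: "g = (p, q, r, s)" by (cases g)
  obtain p' q' r' s' where hd: "h = (p', q', r', s')" by (cases h)
  have c: "p \<in> carrier R" "q \<in> carrier R" "r \<in> carrier R" "s \<in> carrier R"
    using g by (auto simp: gd SL2_def)
  have c': "p' \<in> carrier R" "q' \<in> carrier R" "r' \<in> carrier R" "s' \<in> carrier R"
    using h by (auto simp: hd SL2_def)
  note abR = ab[THEN ideal.Icarr[OF I]]
  have "p' \<otimes> (p \<otimes> a \<oplus> r \<otimes> b) \<oplus> r' \<otimes> (q \<otimes> a \<oplus> s \<otimes> b)
      = (p \<otimes> p' \<oplus> q \<otimes> r') \<otimes> a \<oplus> (r \<otimes> p' \<oplus> s \<otimes> r') \<otimes> b"
    using c c' abR by algebra
  moreover have "q' \<otimes> (p \<otimes> a \<oplus> r \<otimes> b) \<oplus> s' \<otimes> (q \<otimes> a \<oplus> s \<otimes> b)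
      = (p \<otimes> q' \<oplus> q \<otimes> s') \<otimes> a \<oplus> (r \<otimes> q' \<oplus> s \<otimes> s') \<otimes> b"
    using c c' abR by algebra
  ultimately show ?thesis by (simp add: gd hd SL2_def row_action_def)
qed

text \<open>A matrix multiplies the wedge by its determinant, here 1, so the determinant map is
  constant on orbits.\<close>

lemma determinant_map_row_action:
  assumes I: "ideal I R" and ab: "a \<in> I" "b \<in> I" and g: "g \<in> carrier (SL2 R)"
  shows "determinant_map R (ideal_module R I) (row_action (ideal_module R I) g [a, b])
    = determinant_map R (ideal_module R I) [a, b]"
proof -
  interpret M: module R "ideal_module R I" by (rule ideal_module_module[OF I])
  interpret E: module R "exterior_square R (ideal_module R I)" by (rule M.exterior_square_module)
  obtain p q r s where gd: "g = (p, q, r, s)" by (cases g)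
  have c: "p \<in> carrier R" "q \<in> carrier R" "r \<in> carrier R" "s \<in> carrier R"
    and d: "p \<otimes> s \<ominus> q \<otimes> r = \<one>" using g by (auto simp: gd SL2_def)
  show ?thesis
    using M.wedge_determinant[of a b p q r s] ab c d M.wedge_closed[of a b]
    by (simp add: gd row_action_def determinant_map_def)
qed

text \<open>This is injectivity on orbits. A base change between the pairs has determinant 1 modulo
  the relation ideal and is corrected by \<open>base_change_determinant_one\<close>.\<close>

lemma wedge_eq_imp_row_action:
  assumes I: "ideal I R" and reg: "e \<in> I" "regular_element R e"
    and ab: "ideal_pair I a b" and ab': "ideal_pair I a' b'"
    and eq: "wedge R (ideal_module R I) a' b' = wedge R (ideal_module R I) a b"
  obtains g where "g \<in> carrier (SL2 R)" "[a', b'] = row_action (ideal_module R I) g [a, b]"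
proof -
  interpret M: module R "ideal_module R I" by (rule ideal_module_module[OF I])
  have I_carr: "\<And>x. x \<in> I \<Longrightarrow> x \<in> carrier R" using ideal.Icarr[OF I] .
  have abI: "a \<in> I" "b \<in> I" "a' \<in> I" "b' \<in> I" using ab ab' by (auto simp: ideal_pair_def)
  note abR = abI[THEN I_carr]
  obtain p r where A1: "p \<in> carrier R" "r \<in> carrier R" "a' = p \<otimes> a \<oplus> r \<otimes> b"
    using ab abI unfolding ideal_pair_def by blast
  obtain q s where A2: "q \<in> carrier R" "s \<in> carrier R" "b' = q \<otimes> a \<oplus> s \<otimes> b"
    using ab abI unfolding ideal_pair_def by blast
  obtain p' r' where B1: "p' \<in> carrier R" "r' \<in> carrier R" "a = p' \<otimes> a' \<oplus> r' \<otimes> b'"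
    using ab' abI unfolding ideal_pair_def by blast
  obtain q' s' where B2: "q' \<in> carrier R" "s' \<in> carrier R" "b = q' \<otimes> a' \<oplus> s' \<otimes> b'"
    using ab' abI unfolding ideal_pair_def by blast
  obtain c d where e: "c \<in> carrier R" "d \<in> carrier R" "e = c \<otimes> a \<oplus> d \<otimes> b"
    using ab reg unfolding ideal_pair_def by blast
  \<comment> \<open>Whatever kills \<open>a\<close> and \<open>b\<close> kills their combination
    \<open>e\<close>, which is regular.\<close>
  have f: "faithful_pair a b"
    unfolding faithful_pair_def
  proof (intro ballI impI; elim conjE)
    fix x assume x: "x \<in> carrier R" "x \<otimes> a = \<zero>" "x \<otimes> b = \<zero>"
    have "e \<otimes> x = c \<otimes> (x \<otimes> a) \<oplus> d \<otimes> (x \<otimes> b)"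
      unfolding e(3) using e(1,2) x(1) abR by algebra
    then have "e \<otimes> x = \<zero>" using e x by simp
    then show "x = \<zero>" using reg x(1) unfolding regular_element_def by blast
  qed
  have "wedge R (ideal_module R I) a b
      = (p \<otimes> s \<ominus> q \<otimes> r) \<odot>\<^bsub>exterior_square R (ideal_module R I)\<^esub> wedge R (ideal_module R I) a b"
    using M.wedge_determinant[of a b p q r s] A1 A2 abI eq by simp
  then have "\<one> \<ominus> (p \<otimes> s \<ominus> q \<otimes> r) \<in> relation_ideal a b"
    using wedge_eq_smult_self_imp_relation_ideal[OF I ab] A1(1,2) A2(1,2) by simp
  from base_change_determinant_one[OF abR(1,2) A1(1) A2(1) A1(2) A2(2) B1(1) B2(1) B1(2) B2(2) f
      A1(3) A2(3) B1(3) B2(3) this]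
  obtain p1 q1 r1 s1 where "(p1, q1, r1, s1) \<in> carrier (SL2 R)"
    "a' = p1 \<otimes> a \<oplus> r1 \<otimes> b" "b' = q1 \<otimes> a \<oplus> s1 \<otimes> b" by blast
  then show ?thesis using that by (simp add: row_action_def)
qed

text \<open>The sum of the two principal ideals is an ideal containing both generators, and its
  elements are combinations of them.\<close>

lemma genideal_ideal_pair:
  assumes ab: "a \<in> carrier R" "b \<in> carrier R"
  shows "ideal_pair (Idl {a, b}) a b"
proof -
  have self: "{a, b} \<subseteq> Idl {a, b}" using ab by (intro genideal_self) simp
  have "a = \<one> \<otimes> a \<oplus> \<zero> \<otimes> b" "b = \<zero> \<otimes> a \<oplus> \<one> \<otimes> b" using ab by simp_all
  then have "a \<in> PIdl a <+> PIdl b" "b \<in> PIdl a <+> PIdl b"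
    unfolding cgenideal_def set_add_def' by blast+
  then have "Idl {a, b} \<subseteq> PIdl a <+> PIdl b"
    using ab by (intro genideal_minimal add_ideals cgenideal_ideal) simp_all
  then show ?thesis
    using self unfolding ideal_pair_def cgenideal_def set_add_def' by blast
qed

section \<open>The image of the determinant map\<close>

lemma generating_tuples_1:
  "generating_tuples R E 1 = {[w] | w. w \<in> carrier E \<and> generated_submodule R E {w} = carrier E}"
proof (rule subset_antisym; rule subsetI)
  fix v assume v: "v \<in> generating_tuples R E 1"
  then obtain w where "v = [w]"
    unfolding generating_tuples_def One_nat_def length_Suc_conv length_0_conv by blast
  with v show "v \<in> {[w] | w. w \<in> carrier E \<and> generated_submodule R E {w} = carrier E}"
    by (simp add: generating_tuples_def)
next
  fix v assume "v \<in> {[w] | w. w \<in> carrier E \<and> generated_submodule R E {w} = carrier E}"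
  then obtain w where "v = [w]" "w \<in> carrier E" "generated_submodule R E {w} = carrier E" by blast
  then show "v \<in> generating_tuples R E 1"
    by (simp add: generating_tuples_def)
qed

lemma determinant_map_generating:
  assumes I: "ideal I R" and ab: "ideal_pair I a b"
  shows "determinant_map R (ideal_module R I) [a, b]
    \<in> generating_tuples R (exterior_square R (ideal_module R I)) 1"
proof -
  interpret M: module R "ideal_module R I" by (rule ideal_module_module[OF I])
  interpret E: module R "exterior_square R (ideal_module R I)" by (rule M.exterior_square_module)
  have abI: "a \<in> I" "b \<in> I" using ab by (auto simp: ideal_pair_def)
  have w: "wedge R (ideal_module R I) a b \<in> carrier (exterior_square R (ideal_module R I))"
    using M.wedge_closed abI by simp
  have "generated_submodule R (exterior_square R (ideal_module R I)) {wedge R (ideal_module R I) a b}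
      = carrier (exterior_square R (ideal_module R I))"
    unfolding E.generated_submodule_singleton[OF w]
    using M.exterior_square_cyclic[of a b] generated_submodule_ideal_module[OF I abI] ab abI by simp
  then show ?thesis
    unfolding generating_tuples_1 determinant_map_def using w by simp
qed

text \<open>A generator is u (a \<and> b), and it depends only on \<open>u\<close> modulo the
  relation ideal. Choosing \<open>u\<close> within its class as a unit modulo \<open>b\<close>, the
  element \<open>a\<close> is recovered from u a and \<open>b\<close>.\<close>

lemma determinant_map_surj:
  assumes I: "ideal I R" and ab: "ideal_pair I a b" and b: "regular_element R b"
    and sr: "stable_rank_one (R Quot (PIdl b))"
    and v: "v \<in> generating_tuples R (exterior_square R (ideal_module R I)) 1"
  obtains a' b' where "ideal_pair I a' b'" "determinant_map R (ideal_module R I) [a', b'] = v"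
proof -
  let ?E = "exterior_square R (ideal_module R I)"
  let ?w = "wedge R (ideal_module R I) a b"
  interpret M: module R "ideal_module R I" by (rule ideal_module_module[OF I])
  interpret E: module R ?E by (rule M.exterior_square_module)
  have I_carr: "\<And>x. x \<in> I \<Longrightarrow> x \<in> carrier R" using ideal.Icarr[OF I] .
  have abI: "a \<in> I" "b \<in> I" using ab by (auto simp: ideal_pair_def)
  note abR = abI[THEN I_carr]
  have w: "?w \<in> carrier ?E" using M.wedge_closed abI by simp
  have cyc: "carrier ?E = {c \<odot>\<^bsub>?E\<^esub> ?w | c. c \<in> carrier R}"
    using M.exterior_square_cyclic[of a b] generated_submodule_ideal_module[OF I abI] ab abI by simp
  obtain z where z: "v = [z]" "z \<in> carrier ?E" "generated_submodule R ?E {z} = carrier ?E"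
    using v unfolding generating_tuples_1 by blast
  obtain u where u: "u \<in> carrier R" "z = u \<odot>\<^bsub>?E\<^esub> ?w" using z(2) cyc by blast
  \<comment> \<open>As \<open>z\<close> generates, a \<and> b is in turn a multiple of
    \<open>z\<close>; this makes \<open>u\<close> invertible modulo the relation ideal.\<close>
  have "?w \<in> {c \<odot>\<^bsub>?E\<^esub> z | c. c \<in> carrier R}"
    using w z E.generated_submodule_singleton by blast
  then obtain x where x: "x \<in> carrier R" "?w = x \<odot>\<^bsub>?E\<^esub> z" by blast
  then have "?w = (x \<otimes> u) \<odot>\<^bsub>?E\<^esub> ?w" using u w by (simp add: E.smult_assoc1)
  then have ux: "\<one> \<ominus> x \<otimes> u \<in> relation_ideal a b"
    using wedge_eq_smult_self_imp_relation_ideal[OF I ab, of "x \<otimes> u"] x(1) u(1) by blast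
  obtain j y t where j: "j \<in> relation_ideal a b" and y: "y \<in> carrier R" and t: "t \<in> carrier R"
    and one: "(u \<oplus> j) \<otimes> y \<oplus> t \<otimes> b = \<one>"
    using stable_rank_one_lift_unit[OF abR(2) sr relation_ideal_ideal u(1) x(1) ux] by blast
  have jR: "j \<in> carrier R" using ideal.Icarr[OF relation_ideal_ideal j] .
  define a' where "a' = (u \<oplus> j) \<otimes> a"
  have a'I: "a' \<in> I" using ideal.I_l_closed[OF I abI(1)] u jR by (simp add: a'_def)
  have "ideal_pair I a' b"
    unfolding ideal_pair_def
  proof (intro conjI ballI a'I abI(2))
    fix m assume "m \<in> I"
    then obtain c d where cd: "c \<in> carrier R" "d \<in> carrier R" "m = c \<otimes> a \<oplus> d \<otimes> b"
      using ab unfolding ideal_pair_def by blast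
    \<comment> \<open>Multiplying \<open>one\<close> by \<open>a\<close> expresses \<open>a\<close>
      through \<open>a'\<close> and \<open>b\<close>: the product t b a counts as the multiple t a
      of \<open>b\<close>.\<close>
    have "(c \<otimes> y) \<otimes> a' \<oplus> (c \<otimes> t \<otimes> a \<oplus> d) \<otimes> b = c \<otimes> (((u \<oplus> j) \<otimes> y \<oplus> t \<otimes> b) \<otimes> a) \<oplus> d \<otimes> b"
      unfolding a'_def using cd(1,2) y t u(1) jR abR by algebra
    also have "\<dots> = m" unfolding one cd(3) using abR by simp
    finally show "\<exists>c\<in>carrier R. \<exists>d\<in>carrier R. m = c \<otimes> a' \<oplus> d \<otimes> b"
      using cd(1,2) y t abR by (intro bexI[of _ "c \<otimes> y"] bexI[of _ "c \<otimes> t \<otimes> a \<oplus> d"]) simp_all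
  qed
  moreover have "wedge R (ideal_module R I) a' b = z"
    using M.wedge_smult_left[of "u \<oplus> j" a b] relation_ideal_annihilates_wedge[OF I abI j]
      u jR abI w by (simp add: a'_def E.smult_l_distr)
  ultimately show ?thesis using that by (simp add: determinant_map_def z(1))
qed

end

section \<open>The bijection from orbits to generators\<close>

theorem corollary1p2:
  fixes R :: "('a, 'm) ring_scheme" and I :: "'a set"
  assumes "cring R"
    and "\<And>J. regular_ideal R J \<Longrightarrow> stable_rank_one (R Quot J)"
    and "ideal I R"
    and "\<exists>a b. regular_element R a \<and> regular_element R b \<and> I = Idl\<^bsub>R\<^esub> {a, b}"
  shows "\<exists>F. (\<forall>v \<in> generating_tuples R (ideal_module R I) 2.
                F (orbit (SL2 R) (row_action (ideal_module R I)) v)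
                  = determinant_map R (ideal_module R I) v)
           \<and> bij_betw F
               (orbits (SL2 R) (generating_tuples R (ideal_module R I) 2)
                  (row_action (ideal_module R I)))
               (generating_tuples R (exterior_square R (ideal_module R I)) 1)"
proof -
  interpret cring R by (rule assms(1))
  note I = assms(3)
  let ?M = "ideal_module R I"
  let ?V = "generating_tuples R ?M 2"
  let ?O = "\<lambda>v. orbit (SL2 R) (row_action ?M) v"
  let ?d = "determinant_map R ?M"
  obtain a b where reg: "regular_element R a" "regular_element R b" and Iab: "I = Idl\<^bsub>R\<^esub> {a, b}"
    using assms(4) by blast
  have abR: "a \<in> carrier R" "b \<in> carrier R" using reg by (auto simp: regular_element_def)
  have ab: "ideal_pair I a b" unfolding Iab by (rule genideal_ideal_pair[OF abR])
  then have bI: "b \<in> I" by (simp add: ideal_pair_def)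
  \<comment> \<open>The regular generator \<open>b\<close> lies in its principal ideal, so the
    hypothesis on quotients applies to it.\<close>
  have "regular_ideal R (PIdl\<^bsub>R\<^esub> b)"
    unfolding regular_ideal_def
    using cgenideal_ideal[OF abR(2)] cgenideal_self[OF abR(2)] reg(2) by blast
  then have sr: "stable_rank_one (R Quot (PIdl\<^bsub>R\<^esub> b))" by (rule assms(2))
  have V: "\<exists>x y. v = [x, y] \<and> ideal_pair I x y \<and> x \<in> I \<and> y \<in> I" if "v \<in> ?V" for v
    using that unfolding generating_tuples_ideal_module[OF I] ideal_pair_def by blast
  \<comment> \<open>The identity matrix shows that orbits are nonempty, which the choice of
    representatives below relies on.\<close>
  have orbit_self: "v \<in> ?O v" if v: "v \<in> ?V" for v
  proof -
    obtain x y where "v = [x, y]" "x \<in> I" "y \<in> I" using V[OF v] by blast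
    then show ?thesis
      using SL2_row_action_one[OF I, of x y] unfolding orbit_def by (metis (mono_tags, lifting) mem_Collect_eq)
  qed
  have d_orbit: "?d w = ?d v" if v: "v \<in> ?V" and w: "w \<in> ?O v" for v w
  proof -
    obtain x y where "v = [x, y]" "x \<in> I" "y \<in> I" using V[OF v] by blast
    then show ?thesis
      using w determinant_map_row_action[OF I, of x y] unfolding orbit_def by auto
  qed
  \<comment> \<open>The assumption is symmetric in \<open>v\<close> and \<open>w\<close>, so one
    inclusion yields equality of the orbits.\<close>
  have orbit_subset: "?O w \<subseteq> ?O v" if v: "v \<in> ?V" and w: "w \<in> ?V" and eq: "?d v = ?d w" for v w
  proof
    obtain x y where x: "v = [x, y]" "ideal_pair I x y" "x \<in> I" "y \<in> I" using V[OF v] by blast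
    obtain x' y' where x': "w = [x', y']" "ideal_pair I x' y'" using V[OF w] by blast
    have "wedge R ?M x' y' = wedge R ?M x y"
      using eq by (simp add: determinant_map_def x(1) x'(1))
    then obtain g where g: "g \<in> carrier (SL2 R)" "w = row_action ?M g [x, y]"
      using wedge_eq_imp_row_action[OF I bI reg(2) x(2) x'(2)] x'(1) by metis
    fix m assume "m \<in> ?O w"
    then obtain h where h: "h \<in> carrier (SL2 R)" "m = row_action ?M h w"
      unfolding orbit_def by blast
    have "m = row_action ?M (g \<otimes>\<^bsub>SL2 R\<^esub> h) v"
      unfolding h(2) g(2) x(1) by (rule row_action_mult[OF I x(3,4) g(1) h(1)])
    then show "m \<in> ?O v"
      using SL2_mult_closed[OF g(1) h(1)] unfolding orbit_def by blast
  qed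
  \<comment> \<open>An arbitrary representative of the orbit will do, by
    \<open>d_orbit\<close>.\<close>
  define F where "F = (\<lambda>X. ?d (SOME v. v \<in> X))"
  have F: "F (?O v) = ?d v" if v: "v \<in> ?V" for v
    unfolding F_def using d_orbit[OF v] someI[of "\<lambda>w. w \<in> ?O v", OF orbit_self[OF v]] by blast
  have "bij_betw F (orbits (SL2 R) ?V (row_action ?M)) (generating_tuples R (exterior_square R ?M) 1)"
    unfolding bij_betw_def
  proof
    show "inj_on F (orbits (SL2 R) ?V (row_action ?M))"
    proof (rule inj_onI)
      fix X Y assume "X \<in> orbits (SL2 R) ?V (row_action ?M)" "Y \<in> orbits (SL2 R) ?V (row_action ?M)"
      then obtain v w where v: "v \<in> ?V" "X = ?O v" and w: "w \<in> ?V" "Y = ?O w"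
        unfolding orbits_def by blast
      assume "F X = F Y"
      then have "?d v = ?d w" using F v w by simp
      then show "X = Y" using orbit_subset v w by (metis subset_antisym)
    qed
    show "F ` orbits (SL2 R) ?V (row_action ?M) = generating_tuples R (exterior_square R ?M) 1"
    proof (rule subset_antisym; rule subsetI)
      fix z assume "z \<in> F ` orbits (SL2 R) ?V (row_action ?M)"
      then obtain v where v: "v \<in> ?V" "z = F (?O v)" unfolding orbits_def by blast
      then show "z \<in> generating_tuples R (exterior_square R ?M) 1"
        using F determinant_map_generating[OF I] V by metis
    next
      fix z assume z: "z \<in> generating_tuples R (exterior_square R ?M) 1"
      obtain x y where xy: "ideal_pair I x y" "?d [x, y] = z"
        using determinant_map_surj[OF I ab reg(2) sr z] by blast
      then have v: "[x, y] \<in> ?V" unfolding generating_tuples_ideal_module[OF I] by blast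
      then have "?O [x, y] \<in> orbits (SL2 R) ?V (row_action ?M)" unfolding orbits_def by blast
      then show "z \<in> F ` orbits (SL2 R) ?V (row_action ?M)" using F[OF v] xy(2) by force
    qed
  qed
  with F show ?thesis by blast
qed

end
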